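(* For every $u\in W^{2,4}(T^3)$, $$\|u\|_{W^{2,4}(T^3)}\le C_S\big(\|\Delta u\|_{L^4(T^3)}+\|u\|_{L^4(T^3)}\big),$$ where $C_S$ is the constant defined in the context.
   Context: $T^3=\mathbb{R}^3/\mathbb{Z}^3$ with the flat metric; functions are $\mathbb{Z}^3$-periodic functions on $\mathbb{R}^3$; $\Delta=\sum_i\partial_i^2$; $\|u\|_{W^{2,4}}=\|u\|_{L^4}+\|\,|Du|\,\|_{L^4}+\|\,|D^2u|\,\|_{L^4}$ with Euclidean norm of the gradient and Frobenius norm of the Hessian. Constants: $C_{CZ}:=193$; $C_P:=(81/(4\pi))^{1/3}$; $C_{\mathrm{reg}}:=9C_{CZ}(3C_P+1)$; $C_{\Delta\chi}:=-180\big(-6+\tfrac{13}{6}(9+\sqrt3)-\tfrac14(9+\sqrt3)^2+\tfrac1{108}(9+\sqrt3)^3\big)$; $C_{D^2\chi}:=60(5\sqrt3-6)$; $C_H:=27^{1/12}$; $K:=3^{-1/2}(4/\pi^2)^{1/3}$; $C_S:=27\big(1+C_{\mathrm{reg}}C_{\Delta\chi}+(2+54\cdot27\sqrt{17})\,C_{\mathrm{reg}}C_HC_{D^2\chi}K\big)$. *)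

theory Defs
  imports "HOL-Analysis.Analysis"
begin

text \<open>Functions on the flat torus T^3 = R^3/Z^3 are Z^3-periodic functions on R^3.\<close>

definition periodic3 :: "(real^3 \<Rightarrow> 'b) \<Rightarrow> bool" where
  "periodic3 f \<longleftrightarrow> (\<forall>x v. (\<forall>i. v $ i \<in> \<int>) \<longrightarrow> f (x + v) = f x)"

text \<open>Fundamental domain [0,1]^3 with Lebesgue measure (total mass 1 = flat volume of T^3).\<close>

definition cube3 :: "(real^3) set" where
  "cube3 = cbox 0 1"

definition T3 :: "(real^3) measure" where
  "T3 = lebesgue_on cube3"

definition partial :: "3 \<Rightarrow> (real^3 \<Rightarrow> real) \<Rightarrow> real^3 \<Rightarrow> real" where
  "partial i f x = frechet_derivative f (at x) (axis i 1)"

fun Ck :: "nat \<Rightarrow> (real^3 \<Rightarrow> real) \<Rightarrow> bool" where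
  "Ck 0 f = continuous_on UNIV f"
| "Ck (Suc k) f = (f differentiable_on UNIV \<and> continuous_on UNIV f \<and> (\<forall>i. Ck k (partial i f)))"

definition smooth3 :: "(real^3 \<Rightarrow> real) \<Rightarrow> bool" where
  "smooth3 f \<longleftrightarrow> (\<forall>k. Ck k f)"

definition test_fun :: "(real^3 \<Rightarrow> real) \<Rightarrow> bool" where
  "test_fun \<phi> \<longleftrightarrow> smooth3 \<phi> \<and> periodic3 \<phi>"

definition inL4 :: "(real^3 \<Rightarrow> 'b::{real_normed_vector, second_countable_topology}) \<Rightarrow> bool" where
  "inL4 f \<longleftrightarrow> f \<in> borel_measurable T3 \<and> integrable T3 (\<lambda>x. norm (f x) ^ 4)"

definition L4norm :: "(real^3 \<Rightarrow> 'b::real_normed_vector) \<Rightarrow> real" where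
  "L4norm f = (\<integral>x. norm (f x) ^ 4 \<partial>T3) powr (1/4)"

text \<open>u \<in> W^{2,4}(T^3) with weak gradient G and weak Hessian H
  (G $ i = \<partial>_i u, H $ i $ j = \<partial>_i \<partial>_j u in the weak sense on T^3).\<close>

definition W24_weak :: "(real^3 \<Rightarrow> real) \<Rightarrow> (real^3 \<Rightarrow> real^3) \<Rightarrow> (real^3 \<Rightarrow> real^3^3) \<Rightarrow> bool" where
  "W24_weak u G H \<longleftrightarrow> periodic3 u \<and> inL4 u \<and> inL4 G \<and> inL4 H \<and>
     (\<forall>\<phi>. test_fun \<phi> \<longrightarrow>
        (\<forall>i. (\<integral>x. u x * partial i \<phi> x \<partial>T3) = - (\<integral>x. G x $ i * \<phi> x \<partial>T3)) \<and>
        (\<forall>i j. (\<integral>x. u x * partial i (partial j \<phi>) x \<partial>T3) = (\<integral>x. H x $ i $ j * \<phi> x \<partial>T3)))"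

definition lap :: "(real^3 \<Rightarrow> real^3^3) \<Rightarrow> real^3 \<Rightarrow> real" where
  "lap H x = (\<Sum>i\<in>UNIV. H x $ i $ i)"

definition W24norm :: "(real^3 \<Rightarrow> real) \<Rightarrow> (real^3 \<Rightarrow> real^3) \<Rightarrow> (real^3 \<Rightarrow> real^3^3) \<Rightarrow> real" where
  "W24norm u G H = L4norm u + L4norm G + L4norm H"

definition C_CZ :: real where "C_CZ = 193"
definition C_P :: real where "C_P = (81 / (4 * pi)) powr (1/3)"
definition C_reg :: real where "C_reg = 9 * C_CZ * (3 * C_P + 1)"
definition C_Lchi :: real where
  "C_Lchi = - 180 * (- 6 + 13/6 * (9 + sqrt 3) - 1/4 * (9 + sqrt 3)^2 + 1/108 * (9 + sqrt 3)^3)"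
definition C_D2chi :: real where "C_D2chi = 60 * (5 * sqrt 3 - 6)"
definition C_H :: real where "C_H = 27 powr (1/12)"
definition K_const :: real where "K_const = 3 powr (-1/2) * (4 / pi^2) powr (1/3)"
definition C_S :: real where
  "C_S = 27 * (1 + C_reg * C_Lchi + (2 + 54 * 27 * sqrt 17) * C_reg * C_H * C_D2chi * K_const)"

end

theory Submission
  imports Defs
begin

text \<open>
  Everything reduces to trigonometric polynomials, which are dense in \<open>L\<^sup>4\<close>. The heart is the bound
  \<open>\<integral>W\<^sup>4 \<le> 176 \<integral>F\<^sup>4\<close> for \<open>F = \<Delta>u\<close>, \<open>W = \<partial>\<^sub>i\<partial>\<^sub>ju\<close>. Let \<open>F\<close> and \<open>W\<close> evolve by the heat flow; then
  \<open>\<Delta>W = \<partial>\<^sub>i\<partial>\<^sub>jF\<close> at all times, and integrating \<open>W\<^sup>3\<Delta>W\<close> by parts in both forms gives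
  \<open>\<integral>W\<^sup>2|\<nabla>W|\<^sup>2 = \<integral>W\<^sup>2 \<partial>\<^sub>iW \<partial>\<^sub>jF\<close>, hence \<open>\<integral>W\<^sup>2|\<nabla>W|\<^sup>2 \<le> \<integral>W\<^sup>2|\<nabla>F|\<^sup>2\<close>. This makes
  \<open>\<integral>F\<^sup>2W\<^sup>2 - W\<^sup>4/12 + 4F\<^sup>4/3\<close> nonincreasing in time, and since \<open>W \<rightarrow> 0\<close> it is nonnegative at time \<open>0\<close>.
  The gradient is controlled by \<open>\<integral>(\<partial>\<^sub>iu)\<^sup>4 = - 3 \<integral>u (\<partial>\<^sub>iu)\<^sup>2 \<partial>\<^sub>i\<^sub>iu\<close>. A weak solution is compared with
  trigonometric solutions of \<open>u - \<Delta>u = g\<close>, for \<open>g\<close> close to \<open>u - \<Delta>u\<close>. The resulting constant is far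
  below \<open>C_S\<close>.
\<close>

subsection \<open>Trigonometric polynomials\<close>

definition freq :: "int^3 \<Rightarrow> real^3" where
  "freq k = (\<chi> i. 2 * pi * of_int (k $ i))"

text \<open>The complex amplitude carries the phase. Differentiation multiplies it by an imaginary
  number, while the function stays real without any symmetry condition on the coefficients.\<close>

definition wave :: "complex \<Rightarrow> int^3 \<Rightarrow> real^3 \<Rightarrow> real" where
  "wave a k x = Re (a * cis (freq k \<bullet> x))"

text \<open>Frequencies may occur repeatedly in the list, so that a sum is represented by appending.\<close>

definition trig_poly :: "(complex \<times> (int^3)) list \<Rightarrow> real^3 \<Rightarrow> real" where
  "trig_poly L x = (\<Sum>(a, k)\<leftarrow>L. wave a k x)"

text \<open>Derivatives, the Laplacian, the heat flow and the resolvent all act in this way, so they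
  commute with each other because multiplication of complex numbers does.\<close>

definition multiplier :: "(int^3 \<Rightarrow> complex) \<Rightarrow> (complex \<times> (int^3)) list \<Rightarrow> (complex \<times> (int^3)) list" where
  "multiplier m L = map (\<lambda>(a, k). (m k * a, k)) L"

definition D_symbol :: "3 \<Rightarrow> int^3 \<Rightarrow> complex" where
  "D_symbol i k = \<i> * of_real (freq k $ i)"

definition trig :: "(real^3 \<Rightarrow> real) \<Rightarrow> bool" where
  "trig p \<longleftrightarrow> (\<exists>L. p = trig_poly L)"

lemma trig_poly_simps [simp]:
  "trig_poly [] = (\<lambda>x. 0)" "trig_poly ((a, k) # L) = (\<lambda>x. wave a k x + trig_poly L x)"
  by (simp_all add: trig_poly_def fun_eq_iff)

lemma multiplier_simps [simp]:
  "multiplier m [] = []" "multiplier m ((a, k) # L) = (m k * a, k) # multiplier m L"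
  by (simp_all add: multiplier_def)

lemma multiplier_multiplier: "multiplier m (multiplier n L) = multiplier (\<lambda>k. m k * n k) L"
  by (induction L) (auto simp: algebra_simps)

lemma trig_poly_append: "trig_poly (L @ M) = (\<lambda>x. trig_poly L x + trig_poly M x)"
  by (induction L) auto

lemma wave_add_coeff: "wave (a + b) k x = wave a k x + wave b k x"
  by (simp add: wave_def algebra_simps)

lemma wave_scale_coeff: "wave (of_real c * a) k x = c * wave a k x"
  by (simp add: wave_def algebra_simps)

lemma trig_poly_multiplier_add: "trig_poly (multiplier (\<lambda>k. m k + n k) L) x = trig_poly (multiplier m L) x + trig_poly (multiplier n L) x"
  by (induction L) (auto simp: wave_add_coeff distrib_right)

lemma trig_poly_multiplier_sum:
  "trig_poly (multiplier (\<lambda>k. \<Sum>i\<in>I. m i k) L) x = (\<Sum>i\<in>I. trig_poly (multiplier (m i) L) x)"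
proof (induction I rule: infinite_finite_induct)
  case empty
  show ?case by (induction L) (auto simp: wave_def)
next
  case (infinite I)
  have "trig_poly (multiplier (\<lambda>k. 0) L) x = 0" by (induction L) (auto simp: wave_def)
  then show ?case using infinite by simp
qed (auto simp: trig_poly_multiplier_add)

lemma trig_poly_multiplier_scale:
  "trig_poly (multiplier (\<lambda>k. of_real c * m k) L) x = c * trig_poly (multiplier m L) x"
  by (induction L) (auto simp: wave_scale_coeff mult.assoc distrib_left)

lemma multiplier_one: "multiplier (\<lambda>k. 1) L = L"
  by (induction L) auto

lemma freq_add: "freq (k + l) = freq k + freq l"
  by (simp add: freq_def vec_eq_iff algebra_simps)

lemma freq_minus: "freq (- k) = - freq k"
  by (simp add: freq_def vec_eq_iff algebra_simps)

lemma freq_zero [simp]: "freq 0 = 0"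
  by (simp add: freq_def vec_eq_iff)

text \<open>Spectral gap: a nonzero integer coordinate has modulus at least \<open>1\<close>. Hence
  every nonconstant mode decays at least like \<open>exp (- t)\<close> under the heat flow.\<close>

lemma norm_freq_ge_1: assumes "k \<noteq> 0" shows "1 \<le> (norm (freq k))\<^sup>2"
proof -
  obtain i where "k $ i \<noteq> 0" using assms by (auto simp: vec_eq_iff)
  then have "1 \<le> \<bar>of_int (k $ i) :: real\<bar>" by linarith
  moreover have "1 \<le> 2 * pi" using pi_ge_two by simp
  ultimately have "1 * 1 \<le> (2 * pi) * \<bar>of_int (k $ i)\<bar>" by (intro mult_mono) auto
  also have "\<dots> = \<bar>freq k $ i\<bar>" by (simp add: freq_def abs_mult)
  also have "\<dots> \<le> norm (freq k)" by (rule component_le_norm_cart)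
  finally have "1 \<le> norm (freq k)" by simp
  then show ?thesis by (simp add: power2_eq_square mult_ge1_I)
qed

section \<open>The algebra of trigonometric polynomials\<close>

lemma trig_const: "trig (\<lambda>x. c)"
  unfolding trig_def by (rule exI[of _ "[(of_real c, 0)]"]) (simp add: wave_def)

lemma trig_trig_poly [simp, intro]: "trig (trig_poly L)"
  by (auto simp: trig_def)

lemma trig_wave: "trig (wave a k)"
  unfolding trig_def by (rule exI[of _ "[(a, k)]"]) auto

lemma trig_add: "trig p \<Longrightarrow> trig q \<Longrightarrow> trig (\<lambda>x. p x + q x)"
  unfolding trig_def using trig_poly_append by metis

text \<open>\<open>Re z * Re w\<close> is the real part of \<open>(z * w + z * cnj w) / 2\<close>,
  so a product of waves consists of the sum and the difference frequency. This makes powers of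
  trigonometric polynomials available as test functions.\<close>

lemma wave_mult:
  "wave a k x * wave b l x = wave (a * b / 2) (k + l) x + wave (a * cnj b / 2) (k - l) x"
proof -
  define z w where "z = a * cis (freq k \<bullet> x)" and "w = b * cis (freq l \<bullet> x)"
  have 1: "a * b / 2 * cis (freq (k + l) \<bullet> x) = z * w / 2"
    by (simp add: z_def w_def freq_add inner_add_left flip: cis_mult)
  have "freq (k - l) = freq k + - freq l"
    using freq_add[of k "-l"] by (simp add: freq_minus)
  then have 2: "a * cnj b / 2 * cis (freq (k - l) \<bullet> x) = z * cnj w / 2"
    by (simp add: z_def w_def inner_diff_left cis_cnj cis_mult)
  have "Re z * Re w = Re (z * w / 2) + Re (z * cnj w / 2)" by (simp add: field_simps)
  then show ?thesis unfolding wave_def 1 2 by (simp add: z_def w_def)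
qed

lemma trig_mult: assumes "trig p" "trig q" shows "trig (\<lambda>x. p x * q x)"
proof -
  have *: "trig (\<lambda>x. wave a k x * trig_poly M x)" for a k M
  proof (induction M)
    case Nil
    show ?case by (simp add: trig_const)
  next
    case (Cons bl M)
    obtain b l where "bl = (b, l)" by force
    then show ?case
      using trig_add[OF trig_add[OF trig_wave[of "a * b / 2" "k + l"]
        trig_wave[of "a * cnj b / 2" "k - l"]] Cons.IH]
      by (simp add: distrib_left wave_mult)
  qed
  have "trig (\<lambda>x. trig_poly L x * trig_poly M x)" for L M
  proof (induction L)
    case Nil
    show ?case by (simp add: trig_const)
  next
    case (Cons bl L)
    obtain b l where "bl = (b, l)" by force
    then show ?case using trig_add[OF * Cons.IH] by (simp add: distrib_right)
  qed
  then show ?thesis using assms unfolding trig_def by blast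
qed

lemma trig_scale: "trig p \<Longrightarrow> trig (\<lambda>x. c * p x)"
  by (intro trig_mult trig_const)

lemma trig_minus: "trig p \<Longrightarrow> trig (\<lambda>x. - p x)"
  using trig_scale[of p "-1"] by simp

lemma trig_diff: "trig p \<Longrightarrow> trig q \<Longrightarrow> trig (\<lambda>x. p x - q x)"
  using trig_add[OF _ trig_minus] by fastforce

lemma trig_power: "trig p \<Longrightarrow> trig (\<lambda>x. p x ^ n)"
  by (induction n) (auto intro: trig_mult trig_const)

lemma trig_sum: "(\<And>i. i \<in> I \<Longrightarrow> trig (p i)) \<Longrightarrow> trig (\<lambda>x. \<Sum>i\<in>I. p i x)"
  by (induction I rule: infinite_finite_induct) (auto intro: trig_add trig_const)

lemma trig_divide: "trig p \<Longrightarrow> trig (\<lambda>x. p x / c)"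
  using trig_scale[of p "1/c"] by simp

lemmas trig_intros = trig_const trig_add trig_mult trig_minus trig_diff trig_divide trig_power trig_sum trig_trig_poly

section \<open>Derivatives, smoothness and periodicity\<close>

lemma wave_cos_sin: "wave a k x = Re a * cos (freq k \<bullet> x) - Im a * sin (freq k \<bullet> x)"
  by (simp add: wave_def)

lemma wave_has_derivative:
  "(wave a k has_derivative (\<lambda>v. wave (\<i> * of_real (freq k \<bullet> v) * a) k x)) (at x)"
  unfolding wave_cos_sin
  by (auto intro!: derivative_eq_intros simp: fun_eq_iff algebra_simps)

lemma trig_poly_has_derivative:
  "(trig_poly L has_derivative (\<lambda>v. trig_poly (multiplier (\<lambda>k. \<i> * of_real (freq k \<bullet> v)) L) x)) (at x)"
proof (induction L)
  case (Cons ak L)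
  obtain a k where "ak = (a, k)" by force
  then show ?case using has_derivative_add[OF wave_has_derivative[of a k x] Cons.IH] by simp
qed simp

lemma trig_differentiable: "trig p \<Longrightarrow> p differentiable (at x)"
  unfolding trig_def differentiable_def using trig_poly_has_derivative by blast

lemma partial_trig_poly: "partial i (trig_poly L) = trig_poly (multiplier (D_symbol i) L)"
proof
  fix x
  have "freq k \<bullet> axis i 1 = freq k $ i" for k
    by (simp add: inner_axis)
  then show "partial i (trig_poly L) x = trig_poly (multiplier (D_symbol i) L) x"
    unfolding partial_def frechet_derivative_at[OF trig_poly_has_derivative, symmetric]
    by (simp add: D_symbol_def[abs_def])
qed

lemma trig_partial: "trig p \<Longrightarrow> trig (partial i p)"
  by (auto simp: trig_def partial_trig_poly)

lemma trig_continuous: "trig p \<Longrightarrow> continuous_on S p"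
  by (meson differentiable_imp_continuous_on differentiable_at_imp_differentiable_on trig_differentiable)

lemma partial_add:
  assumes "trig p" "trig q"
  shows "partial i (\<lambda>x. p x + q x) x = partial i p x + partial i q x"
proof -
  have *: "(p has_derivative frechet_derivative p (at x)) (at x)" "(q has_derivative frechet_derivative q (at x)) (at x)"
    using assms trig_differentiable frechet_derivative_works by blast+
  show ?thesis unfolding partial_def
    using frechet_derivative_at[OF has_derivative_add[OF *]] by metis
qed

lemma partial_mult:
  assumes "trig p" "trig q"
  shows "partial i (\<lambda>x. p x * q x) x = p x * partial i q x + partial i p x * q x"
proof -
  have *: "(p has_derivative frechet_derivative p (at x)) (at x)" "(q has_derivative frechet_derivative q (at x)) (at x)"
    using assms trig_differentiable frechet_derivative_works by blast+
  show ?thesis unfolding partial_def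
    using frechet_derivative_at[OF has_derivative_mult[OF *]] by metis
qed

lemma partial_scale: "trig p \<Longrightarrow> partial i (\<lambda>x. c * p x) x = c * partial i p x"
proof -
  assume p: "trig p"
  have "partial i (\<lambda>x. c) x = 0"
    by (simp add: partial_def)
  then show ?thesis using partial_mult[OF trig_const p, of i c x] by simp
qed

lemma partial_power:
  assumes "trig p"
  shows "partial i (\<lambda>x. p x ^ n) x = of_nat n * p x ^ (n - 1) * partial i p x"
proof (induction n)
  case 0
  show ?case by (simp add: partial_def)
next
  case (Suc n)
  have "partial i (\<lambda>x. p x ^ Suc n) x = p x * partial i (\<lambda>x. p x ^ n) x + partial i p x * p x ^ n"
    using partial_mult[OF assms trig_power[OF assms], of i n x] by simp
  then show ?case using Suc by (cases n) (auto simp: algebra_simps)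
qed

lemma trig_partial_commute:
  assumes "trig p" shows "partial i (partial j p) = partial j (partial i p)"
  using assms by (auto simp: trig_def partial_trig_poly multiplier_multiplier mult.commute)

lemma trig_smooth: assumes "trig p" shows "smooth3 p"
proof -
  have "Ck n p" for n
    using assms
  proof (induction n arbitrary: p)
    case (Suc n)
    then show ?case
      by (auto simp: trig_continuous trig_partial differentiable_at_imp_differentiable_on trig_differentiable)
  qed (simp add: trig_continuous)
  then show ?thesis by (simp add: smooth3_def)
qed

lemma trig_periodic: assumes "trig p" shows "periodic3 p"
proof -
  have *: "cis (freq k \<bullet> v) = 1" if "\<forall>i. v $ i \<in> \<int>" for v k
  proof -
    have "\<exists>n. v $ i = of_int n" for i using that by (auto elim: Ints_cases)
    then obtain n where n: "\<And>i. v $ i = of_int (n i)" by metis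
    have "freq k \<bullet> v = 2 * pi * of_int (\<Sum>i\<in>UNIV. k $ i * n i)"
      by (simp add: inner_vec_def freq_def n sum_distrib_left mult.assoc)
    then show ?thesis by (simp only: cis_multiple_2pi Ints_of_int)
  qed
  have "wave a k (x + v) = wave a k x" if "\<forall>i. v $ i \<in> \<int>" for v a k x
    using *[OF that] by (simp add: wave_def inner_add_right flip: cis_mult)
  then have "trig_poly L (x + v) = trig_poly L x" if "\<forall>i. v $ i \<in> \<int>" for v L x
    using that by (induction L) auto
  then show ?thesis using assms by (auto simp: trig_def periodic3_def)
qed

text \<open>The weak formulation enters through this fact: it is tested with trigonometric
  polynomials only.\<close>

lemma trig_test_fun: "trig p \<Longrightarrow> test_fun p"
  by (simp add: test_fun_def trig_smooth trig_periodic)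

section \<open>Integration over the torus and integration by parts\<close>

lemma T3_continuous:
  fixes f :: "real^3 \<Rightarrow> real"
  assumes "continuous_on cube3 f"
  shows "integrable T3 f" "(\<integral>x. f x \<partial>T3) = integral cube3 f"
proof -
  show "integrable T3 f"
    using assms continuous_imp_integrable unfolding T3_def cube3_def by blast
  then show "(\<integral>x. f x \<partial>T3) = integral cube3 f"
    unfolding T3_def by (intro lebesgue_integral_eq_integral) (auto simp: cube3_def)
qed

lemma trig_integrable: "trig p \<Longrightarrow> integrable T3 p"
  by (simp add: T3_continuous trig_continuous)

text \<open>Cut the cube at \<open>x\<^sub>i = s\<close> and move the lower slab up by one period.\<close>

lemma integral_cube_shift:
  fixes f :: "real^3 \<Rightarrow> real"
  assumes cont: "continuous_on UNIV f" and per: "periodic3 f" and s: "0 \<le> s" "s \<le> 1"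
  shows "integral cube3 (\<lambda>x. f (x + axis i s)) = integral cube3 f"
proof -
  define e :: "real^3" where "e = axis i 1"
  have eB: "e \<in> Basis" by (simp add: e_def axis_in_Basis_iff)
  have int: "f integrable_on cbox a b" for a b
    using cont by (meson continuous_on_subset integrable_continuous subset_UNIV)
  have xe: "x \<bullet> e = x $ i" for x by (simp add: e_def inner_axis)
  have e_nth: "e $ j = (if j = i then 1 else 0)" for j by (simp add: e_def axis_def)
  have e1: "axis i s = s *\<^sub>R e" by (simp add: e_def vec_eq_iff axis_def)
  have "integral cube3 (\<lambda>x. f (x + axis i s)) = integral (cbox (s *\<^sub>R e) (1 + s *\<^sub>R e)) f"
    using integral_shift_cbox[of "s *\<^sub>R e" "s *\<^sub>R e" "1 + s *\<^sub>R e" f] by (simp add: cube3_def e1)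
  also have "\<dots> = integral (cbox (s *\<^sub>R e) (1 + s *\<^sub>R e) \<inter> {x. x \<bullet> e \<le> 1}) f
      + integral (cbox (s *\<^sub>R e) (1 + s *\<^sub>R e) \<inter> {x. x \<bullet> e \<ge> 1}) f"
    by (rule integral_split[OF int eB])
  also have "cbox (s *\<^sub>R e) (1 + s *\<^sub>R e) \<inter> {x. x \<bullet> e \<le> 1} = cbox (s *\<^sub>R e) 1"
    using s by (intro set_eqI) (simp add: xe mem_box_cart e_nth, smt (verit))
  also have "cbox (s *\<^sub>R e) (1 + s *\<^sub>R e) \<inter> {x. x \<bullet> e \<ge> 1} = cbox e (1 + s *\<^sub>R e)"
    using s by (intro set_eqI) (simp add: xe mem_box_cart e_nth, smt (verit))
  also have "integral (cbox e (1 + s *\<^sub>R e)) f = integral (cbox 0 (1 + s *\<^sub>R e - e)) (\<lambda>x. f (x + e))"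
    using integral_shift_cbox[of e e "1 + s *\<^sub>R e" f] by simp
  also have "(\<lambda>x. f (x + e)) = f"
    using per by (auto simp: periodic3_def e_def axis_def fun_eq_iff)
  also have "cbox 0 (1 + s *\<^sub>R e - e) = cbox 0 1 \<inter> {x. x \<bullet> e \<le> s}"
    using s by (intro set_eqI) (simp add: xe mem_box_cart e_nth, smt (verit))
  also have "cbox (s *\<^sub>R e) 1 = cbox 0 1 \<inter> {x. x \<bullet> e \<ge> s}"
    using s by (intro set_eqI) (simp add: xe mem_box_cart e_nth, smt (verit))
  also have "integral (cbox 0 1 \<inter> {x. x \<bullet> e \<ge> s}) f + integral (cbox 0 1 \<inter> {x. x \<bullet> e \<le> s}) f
      = integral cube3 f"
    using integral_split[OF int eB, of 0 1 s] by (simp add: cube3_def)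
  finally show ?thesis .
qed

text \<open>A shift by half a wavelength along a coordinate on which the wave depends reverses its
  sign, so the integral equals its own negative.\<close>

lemma integral_wave:
  assumes "k \<noteq> 0" shows "(\<integral>x. wave a k x \<partial>T3) = 0"
proof -
  obtain i where ki: "k $ i \<noteq> 0" using assms by (auto simp: vec_eq_iff)
  define s where "s = 1 / (2 * \<bar>of_int (k $ i) :: real\<bar>)"
  have k1: "1 \<le> \<bar>of_int (k $ i) :: real\<bar>" using ki by linarith
  then have s: "0 \<le> s" "s \<le> 1" by (auto simp: s_def field_simps)
  have "freq k \<bullet> axis i s = freq k $ i * s" by (simp add: inner_axis)
  also have "\<dots> = pi \<or> \<dots> = - pi"
    using k1 by (auto simp: freq_def s_def abs_if)
  finally have "cis (freq k \<bullet> axis i s) = -1" by (auto simp: complex_eq_iff)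
  then have *: "wave a k (x + axis i s) = - wave a k x" for x
    by (simp add: wave_def inner_add_right flip: cis_mult)
  have t: "trig (wave a k)" by (rule trig_wave)
  show ?thesis
    using integral_cube_shift[OF trig_continuous[OF t] trig_periodic[OF t] s, of i]
    unfolding * by (simp add: T3_continuous trig_continuous[OF t])
qed

text \<open>The symbol of a derivative vanishes at frequency zero, and every other mode has mean
  zero. Integration by parts therefore produces no boundary terms.\<close>

lemma integral_partial: assumes "trig p" shows "(\<integral>x. partial i p x \<partial>T3) = 0"
proof -
  have "(\<integral>x. trig_poly (multiplier (D_symbol i) L) x \<partial>T3) = 0" for L
  proof (induction L)
    case (Cons ak L)
    obtain a k where ak: "ak = (a, k)" by force
    have "(\<integral>x. wave (D_symbol i k * a) k x \<partial>T3) = 0"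
      by (cases "k = 0") (simp add: D_symbol_def wave_def, rule integral_wave)
    then show ?case using Cons.IH
      by (simp add: ak trig_integrable trig_wave)
  qed simp
  then show ?thesis using assms by (auto simp: trig_def partial_trig_poly)
qed

lemma integral_by_parts:
  assumes "trig p" "trig q"
  shows "(\<integral>x. p x * partial i q x \<partial>T3) = - (\<integral>x. partial i p x * q x \<partial>T3)"
proof -
  have "(\<integral>x. p x * partial i q x + partial i p x * q x \<partial>T3) = 0"
    using integral_partial[OF trig_mult[OF assms], of i] by (simp add: partial_mult[OF assms])
  then show ?thesis
    using assms by (simp add: trig_integrable trig_mult trig_partial)
qed

definition laplacian :: "(real^3 \<Rightarrow> real) \<Rightarrow> real^3 \<Rightarrow> real" where
  "laplacian p x = (\<Sum>i\<in>UNIV. partial i (partial i p) x)"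

lemma trig_laplacian: "trig p \<Longrightarrow> trig (laplacian p)"
  unfolding laplacian_def[abs_def] by (intro trig_sum trig_partial)

lemma laplacian_trig_poly: "laplacian (trig_poly L) = trig_poly (multiplier (\<lambda>k. - of_real ((norm (freq k))\<^sup>2)) L)"
proof
  fix x
  have *: "- of_real ((norm (freq k))\<^sup>2) = (\<Sum>i\<in>UNIV. D_symbol i k * D_symbol i k)" for k
    unfolding D_symbol_def power2_norm_eq_inner inner_vec_def
    by (simp add: sum_negf algebra_simps)
  show "laplacian (trig_poly L) x = trig_poly (multiplier (\<lambda>k. - of_real ((norm (freq k))\<^sup>2)) L) x"
    unfolding * trig_poly_multiplier_sum laplacian_def partial_trig_poly multiplier_multiplier ..
qed

lemma integral_laplacian_by_parts:
  assumes "trig p" "trig q"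
  shows "(\<integral>x. p x * laplacian q x \<partial>T3) = - (\<integral>x. (\<Sum>i\<in>UNIV. partial i p x * partial i q x) \<partial>T3)"
proof -
  have "(\<integral>x. p x * laplacian q x \<partial>T3) = (\<Sum>i\<in>UNIV. \<integral>x. p x * partial i (partial i q) x \<partial>T3)"
    unfolding laplacian_def sum_distrib_left
    using assms by (intro Bochner_Integration.integral_sum trig_integrable trig_intros trig_partial)
  also have "\<dots> = - (\<Sum>i\<in>UNIV. \<integral>x. partial i p x * partial i q x \<partial>T3)"
    using assms by (simp add: integral_by_parts trig_partial sum_negf)
  also have "(\<Sum>i\<in>UNIV. \<integral>x. partial i p x * partial i q x \<partial>T3) = (\<integral>x. (\<Sum>i\<in>UNIV. partial i p x * partial i q x) \<partial>T3)"
    using assms by (intro Bochner_Integration.integral_sum[symmetric] trig_integrable trig_intros trig_partial)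
  finally show ?thesis .
qed

declare trig_intros [simp] trig_partial [simp] trig_laplacian [simp] trig_integrable [simp]

subsection \<open>The Hessian estimate by heat flow\<close>

lemma partial_cubic:
  assumes "trig p" "trig q"
  shows "partial l (\<lambda>x. 2 * (p x * q x ^ 2)) x = 2 * q x ^ 2 * partial l p x + 4 * p x * q x * partial l q x"
    and "partial l (\<lambda>x. p x ^ 3) x = 3 * p x ^ 2 * partial l p x"
  using assms
  by (simp_all add: partial_scale partial_mult partial_power)

text \<open>The two cubic identities for \<open>q^3\<close> express \<open>\<integral>q\<^sup>2\<bar>\<nabla>q\<bar>\<^sup>2\<close> both through \<open>\<Delta>q\<close> and through
  \<open>\<partial>\<^sub>i\<partial>\<^sub>jp\<close>; comparing them is where the relation between \<open>p\<close> and \<open>q\<close> enters.\<close>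

lemma weighted_gradient_le:
  assumes p: "trig p" and q: "trig q" and eq: "laplacian q = partial i (partial j p)"
  shows "(\<integral>x. q x ^ 2 * (\<Sum>l\<in>UNIV. (partial l q x)\<^sup>2) \<partial>T3) \<le> (\<integral>x. q x ^ 2 * (\<Sum>l\<in>UNIV. (partial l p x)\<^sup>2) \<partial>T3)"
    (is "?A \<le> ?B")
proof -
  note [simp] = p q
  have "(\<integral>x. q x ^ 3 * laplacian q x \<partial>T3) = - (\<integral>x. (\<Sum>l\<in>UNIV. 3 * q x ^ 2 * partial l q x * partial l q x) \<partial>T3)"
    by (subst integral_laplacian_by_parts) (simp_all add: partial_cubic[OF p q] partial_cubic(2)[OF q q])
  also have "\<dots> = - (\<integral>x. 3 * (q x ^ 2 * (\<Sum>l\<in>UNIV. (partial l q x)\<^sup>2)) \<partial>T3)"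
    by (simp add: sum_distrib_left power2_eq_square mult_ac)
  finally have 1: "(\<integral>x. q x ^ 3 * laplacian q x \<partial>T3) = - 3 * ?A" by simp
  have "(\<integral>x. q x ^ 3 * partial i (partial j p) x \<partial>T3) = - (\<integral>x. 3 * q x ^ 2 * partial i q x * partial j p x \<partial>T3)"
    by (subst integral_by_parts) (simp_all add: partial_cubic(2)[OF q q])
  also have "\<dots> = - (\<integral>x. 3 * (q x ^ 2 * (partial i q x * partial j p x)) \<partial>T3)"
    by (simp add: mult_ac)
  finally have 2: "(\<integral>x. q x ^ 3 * partial i (partial j p) x \<partial>T3) = - 3 * (\<integral>x. q x ^ 2 * (partial i q x * partial j p x) \<partial>T3)"
    by simp
  have "?A = (\<integral>x. q x ^ 2 * (partial i q x * partial j p x) \<partial>T3)"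
    using 1 2 eq by simp
  \<comment> \<open>By the inequality of arithmetic and geometric means, and after enlarging single
    components to full gradients, \<open>?A\<close> returns with factor \<open>1/2\<close> and can
    be absorbed on the left.\<close>
  also have "\<dots> \<le> (\<integral>x. (1/2) * (q x ^ 2 * (\<Sum>l\<in>UNIV. (partial l q x)\<^sup>2)) + (1/2) * (q x ^ 2 * (\<Sum>l\<in>UNIV. (partial l p x)\<^sup>2)) \<partial>T3)"
  proof (rule integral_mono)
    fix x
    have "2 * (partial i q x * partial j p x) \<le> (partial i q x)\<^sup>2 + (partial j p x)\<^sup>2"
      using sum_squares_bound[of "partial i q x" "partial j p x"] by simp
    also have "\<dots> \<le> (\<Sum>l\<in>UNIV. (partial l q x)\<^sup>2) + (\<Sum>l\<in>UNIV. (partial l p x)\<^sup>2)"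
      by (intro add_mono member_le_sum) auto
    finally have "partial i q x * partial j p x \<le> (1/2) * ((\<Sum>l\<in>UNIV. (partial l q x)\<^sup>2) + (\<Sum>l\<in>UNIV. (partial l p x)\<^sup>2))"
      by simp
    from mult_left_mono[OF this, of "q x ^ 2"]
    show "q x ^ 2 * (partial i q x * partial j p x)
      \<le> (1/2) * (q x ^ 2 * (\<Sum>l\<in>UNIV. (partial l q x)\<^sup>2)) + (1/2) * (q x ^ 2 * (\<Sum>l\<in>UNIV. (partial l p x)\<^sup>2))"
      by (simp add: algebra_simps)
  qed simp_all
  also have "\<dots> = (\<integral>x. (1/2) * (q x ^ 2 * (\<Sum>l\<in>UNIV. (partial l q x)\<^sup>2)) \<partial>T3) + (\<integral>x. (1/2) * (q x ^ 2 * (\<Sum>l\<in>UNIV. (partial l p x)\<^sup>2)) \<partial>T3)"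
    by (rule Bochner_Integration.integral_add) auto
  also have "\<dots> = ?A / 2 + ?B / 2" by simp
  finally show ?thesis by simp
qed

text \<open>The integrand is the time derivative of \<open>p^2 q^2 - q^4 / 12 + 4/3 p^4\<close> when
  \<open>p\<close> and \<open>q\<close> solve the heat equation. Integration by parts turns it into
  minus a quadratic form in the two gradients. That form need not be positive pointwise, but it is
  at least \<open>2 q^2 |grad p|^2 - 2 q^2 |grad q|^2\<close>, whose integral is nonnegative by
  \<open>weighted_gradient_le\<close>.\<close>

lemma dissipation:
  assumes p: "trig p" and q: "trig q" and eq: "laplacian q = partial i (partial j p)"
  shows "(\<integral>x. 2 * p x * q x ^ 2 * laplacian p x + 2 * p x ^ 2 * q x * laplacian q x
      - q x ^ 3 * laplacian q x / 3 + 16 / 3 * p x ^ 3 * laplacian p x \<partial>T3) \<le> 0"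
proof -
  note [simp] = p q
  let ?I = "\<lambda>f. (\<integral>x. f x \<partial>T3)"
  have 1: "?I (\<lambda>x. 2 * (p x * q x ^ 2) * laplacian p x)
     = - ?I (\<lambda>x. \<Sum>l\<in>UNIV. (2 * q x ^ 2 * partial l p x + 4 * p x * q x * partial l q x) * partial l p x)"
    by (subst integral_laplacian_by_parts) (simp_all add: partial_cubic(1)[OF p q])
  have 2: "?I (\<lambda>x. 2 * (q x * p x ^ 2) * laplacian q x)
     = - ?I (\<lambda>x. \<Sum>l\<in>UNIV. (2 * p x ^ 2 * partial l q x + 4 * q x * p x * partial l p x) * partial l q x)"
    by (subst integral_laplacian_by_parts) (simp_all add: partial_cubic(1)[OF q p])
  have 3: "?I (\<lambda>x. q x ^ 3 * laplacian q x) = - ?I (\<lambda>x. \<Sum>l\<in>UNIV. 3 * q x ^ 2 * partial l q x * partial l q x)"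
    by (subst integral_laplacian_by_parts) (simp_all add: partial_cubic(2)[OF q q])
  have 4: "?I (\<lambda>x. p x ^ 3 * laplacian p x) = - ?I (\<lambda>x. \<Sum>l\<in>UNIV. 3 * p x ^ 2 * partial l p x * partial l p x)"
    by (subst integral_laplacian_by_parts) (simp_all add: partial_cubic(2)[OF p p])
  have "?I (\<lambda>x. 2 * p x * q x ^ 2 * laplacian p x + 2 * p x ^ 2 * q x * laplacian q x
      - q x ^ 3 * laplacian q x / 3 + 16 / 3 * p x ^ 3 * laplacian p x)
     = ?I (\<lambda>x. 2 * (p x * q x ^ 2) * laplacian p x + 2 * (q x * p x ^ 2) * laplacian q x
      + (-1/3) * (q x ^ 3 * laplacian q x) + 16 / 3 * (p x ^ 3 * laplacian p x))"
    by (simp add: mult_ac)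
  also have "\<dots> = ?I (\<lambda>x. 2 * (p x * q x ^ 2) * laplacian p x) + ?I (\<lambda>x. 2 * (q x * p x ^ 2) * laplacian q x)
      + (-1/3) * ?I (\<lambda>x. q x ^ 3 * laplacian q x) + 16 / 3 * ?I (\<lambda>x. p x ^ 3 * laplacian p x)"
    by (subst Bochner_Integration.integral_add, simp, simp)+ (simp only: integral_mult_right_zero)
  also have "\<dots> = - (?I (\<lambda>x. \<Sum>l\<in>UNIV. (2 * q x ^ 2 * partial l p x + 4 * p x * q x * partial l q x) * partial l p x)
     + ?I (\<lambda>x. \<Sum>l\<in>UNIV. (2 * p x ^ 2 * partial l q x + 4 * q x * p x * partial l p x) * partial l q x)
     + (-1/3) * ?I (\<lambda>x. \<Sum>l\<in>UNIV. 3 * q x ^ 2 * partial l q x * partial l q x)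
     + 16 / 3 * ?I (\<lambda>x. \<Sum>l\<in>UNIV. 3 * p x ^ 2 * partial l p x * partial l p x))"
    unfolding 1 2 3 4 by simp
  also have "\<dots> = - ?I (\<lambda>x. (\<Sum>l\<in>UNIV. (2 * q x ^ 2 * partial l p x + 4 * p x * q x * partial l q x) * partial l p x)
     + (\<Sum>l\<in>UNIV. (2 * p x ^ 2 * partial l q x + 4 * q x * p x * partial l p x) * partial l q x)
     + (-1/3) * (\<Sum>l\<in>UNIV. 3 * q x ^ 2 * partial l q x * partial l q x)
     + 16 / 3 * (\<Sum>l\<in>UNIV. 3 * p x ^ 2 * partial l p x * partial l p x))"
    by (subst Bochner_Integration.integral_add, simp, simp)+ (simp only: integral_mult_right_zero)
  also have "\<dots> \<le> - ?I (\<lambda>x. 2 * (q x ^ 2 * (\<Sum>l\<in>UNIV. (partial l p x)\<^sup>2)) - 2 * (q x ^ 2 * (\<Sum>l\<in>UNIV. (partial l q x)\<^sup>2)))"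
  proof (intro le_imp_neg_le integral_mono)
    fix x
    have "(2 * q x ^ 2 * a\<^sup>2 - 2 * q x ^ 2 * b\<^sup>2) \<le> (2 * q x ^ 2 * a + 4 * p x * q x * b) * a
       + (2 * p x ^ 2 * b + 4 * q x * p x * a) * b + (-1/3) * (3 * q x ^ 2 * b * b) + 16 / 3 * (3 * p x ^ 2 * a * a)" for a b
    proof -
      \<comment> \<open>This sum of squares is exactly the difference of the two sides. The
        coefficients \<open>1/12\<close> and \<open>4/3\<close> of the functional are chosen so that
        the mixed term \<open>8 p q a b\<close> completes a square.\<close>
      have "0 \<le> (q x * b + 4 * (p x * a))\<^sup>2 + 2 * (p x * b)\<^sup>2" by simp
      then show ?thesis by (simp add: power2_eq_square algebra_simps)
    qed
    note * = this
    show "2 * (q x ^ 2 * (\<Sum>l\<in>UNIV. (partial l p x)\<^sup>2)) - 2 * (q x ^ 2 * (\<Sum>l\<in>UNIV. (partial l q x)\<^sup>2))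
      \<le> (\<Sum>l\<in>UNIV. (2 * q x ^ 2 * partial l p x + 4 * p x * q x * partial l q x) * partial l p x)
     + (\<Sum>l\<in>UNIV. (2 * p x ^ 2 * partial l q x + 4 * q x * p x * partial l p x) * partial l q x)
     + (-1/3) * (\<Sum>l\<in>UNIV. 3 * q x ^ 2 * partial l q x * partial l q x)
     + 16 / 3 * (\<Sum>l\<in>UNIV. 3 * p x ^ 2 * partial l p x * partial l p x)"
      unfolding sum_distrib_left sum.distrib[symmetric] sum_subtractf[symmetric]
      using * by (intro sum_mono) (simp add: mult.assoc)
  qed simp_all
  also have "\<dots> = - (2 * ?I (\<lambda>x. q x ^ 2 * (\<Sum>l\<in>UNIV. (partial l p x)\<^sup>2)) - 2 * ?I (\<lambda>x. q x ^ 2 * (\<Sum>l\<in>UNIV. (partial l q x)\<^sup>2)))"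
    by (subst Bochner_Integration.integral_diff, simp, simp) (simp only: integral_mult_right_zero)
  also have "\<dots> \<le> 0" using weighted_gradient_le[OF assms] by simp
  finally show ?thesis .
qed

section \<open>The heat flow and its decay\<close>

lemma measure_T3: "measure T3 (space T3) = 1"
  using content_cbox_cart[of "0::real^3" 1]
  by (simp add: T3_def cube3_def measure_restrict_space interval_ne_empty_cart)

text \<open>The heat semigroup. With finitely many modes it also makes sense for negative times, so
  the time derivative at \<open>0\<close> is two-sided.\<close>

definition heat :: "real \<Rightarrow> (complex \<times> (int^3)) list \<Rightarrow> (complex \<times> (int^3)) list" where
  "heat t = multiplier (\<lambda>k. of_real (exp (- t * (norm (freq k))\<^sup>2)))"

lemma multiplier_commute: "multiplier m (multiplier n L) = multiplier n (multiplier m L)"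
  by (simp add: multiplier_multiplier mult.commute)

lemma heat_0: "heat 0 L = L"
  by (simp add: heat_def multiplier_one)

lemma heat_multiplier: "multiplier m (heat t L) = heat t (multiplier m L)"
  by (simp add: heat_def multiplier_commute)

lemma heat_has_derivative:
  "((\<lambda>t. trig_poly (heat t L) x) has_real_derivative laplacian (trig_poly (heat t L)) x) (at t)"
  unfolding laplacian_trig_poly heat_def
proof (induction L)
  case (Cons ak L)
  obtain a k where ak: "ak = (a, k)" by force
  have *: "wave (of_real c * b) k x = c * wave b k x" for c b by (rule wave_scale_coeff)
  have "((\<lambda>t. exp (- t * (norm (freq k))\<^sup>2) * wave a k x) has_real_derivative
     - (norm (freq k))\<^sup>2 * (exp (- t * (norm (freq k))\<^sup>2) * wave a k x)) (at t)"
    by (auto intro!: derivative_eq_intros)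
  moreover have "wave (- of_real ((norm (freq k))\<^sup>2) * (of_real (exp (- t * (norm (freq k))\<^sup>2)) * a)) k x
    = - (norm (freq k))\<^sup>2 * (exp (- t * (norm (freq k))\<^sup>2) * wave a k x)"
    by (simp only: * of_real_minus[symmetric])
  ultimately have "((\<lambda>t. wave (of_real (exp (- t * (norm (freq k))\<^sup>2)) * a) k x) has_real_derivative
     wave (- of_real ((norm (freq k))\<^sup>2) * (of_real (exp (- t * (norm (freq k))\<^sup>2)) * a)) k x) (at t)"
    unfolding * by simp
  from DERIV_add[OF this Cons.IH] show ?case
    by (simp only: ak multiplier_simps trig_poly_simps)
qed simp

lemma continuous_heat:
  "continuous_on UNIV (\<lambda>(t, x). trig_poly (heat t L) x)"
  unfolding heat_def split_def
proof (induction L)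
  case (Cons ak L)
  obtain a k where ak: "ak = (a, k)" by force
  have "continuous_on UNIV (\<lambda>y. wave (of_real (exp (- fst y * (norm (freq k))\<^sup>2)) * a) k (snd y))"
    unfolding wave_scale_coeff wave_cos_sin
    by (intro continuous_intros)
  then show ?case using Cons.IH by (simp add: ak continuous_on_add)
qed simp

text \<open>The hypothesis excludes the mean value, the only mode that the flow preserves; the
  spectral gap handles all others. A suitable \<open>M\<close> is the sum of the moduli of the
  amplitudes.\<close>

lemma heat_decay:
  assumes "\<forall>(a, k) \<in> set L. k = 0 \<longrightarrow> a = 0"
  shows "\<exists>M. \<forall>t\<ge>0. \<forall>x. \<bar>trig_poly (heat t L) x\<bar> \<le> M * exp (- t)"
  using assms
proof (induction L)
  case Nil
  show ?case by (intro exI[of _ 0]) (simp add: heat_def)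
next
  case (Cons ak L)
  obtain a k where ak: "ak = (a, k)" by force
  obtain M where M: "\<And>t x. t \<ge> 0 \<Longrightarrow> \<bar>trig_poly (heat t L) x\<bar> \<le> M * exp (- t)"
    using Cons by auto
  have "\<bar>wave a k x\<bar> \<le> norm a" for x
    using abs_Re_le_cmod[of "a * cis (freq k \<bullet> x)"] by (simp add: wave_def norm_mult)
  moreover have "exp (- t * (norm (freq k))\<^sup>2) * norm a \<le> norm a * exp (- t)" if "t \<ge> 0" for t
  proof (cases "k = 0")
    case True
    then show ?thesis using Cons.prems ak by simp
  next
    case False
    then have "t * 1 \<le> t * (norm (freq k))\<^sup>2" using that norm_freq_ge_1 by (intro mult_left_mono) auto
    then show ?thesis by (simp add: mult.commute mult_left_mono)
  qed
  ultimately have "\<bar>wave (of_real (exp (- t * (norm (freq k))\<^sup>2)) * a) k x\<bar> \<le> norm a * exp (- t)" if "t \<ge> 0" for t x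
    unfolding wave_scale_coeff abs_mult abs_exp_cancel
    using that by (meson exp_ge_zero mult_left_mono order_trans)
  then have "\<bar>trig_poly (heat t (ak # L)) x\<bar> \<le> (norm a + M) * exp (- t)" if "t \<ge> 0" for t x
    unfolding ak heat_def multiplier_simps trig_poly_simps distrib_right
    using that M[unfolded heat_def] by (intro order_trans[OF abs_triangle_ineq] add_mono)
  then show ?case by blast
qed

lemma hessian_estimate:
  assumes "trig u"
  shows "(\<integral>x. partial i (partial j u) x ^ 4 \<partial>T3) \<le> 176 * (\<integral>x. laplacian u x ^ 4 \<partial>T3)"
proof -
  obtain L where u: "u = trig_poly L" using assms by (auto simp: trig_def)
  define LF where "LF = multiplier (\<lambda>k. - of_real ((norm (freq k))\<^sup>2)) L"
  define LW where "LW = multiplier (D_symbol i) (multiplier (D_symbol j) L)"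
  define F where "F t = trig_poly (heat t LF)" for t
  define W where "W t = trig_poly (heat t LW)" for t
  have F0: "F 0 = laplacian u" by (simp add: F_def heat_0 LF_def u laplacian_trig_poly)
  have W0: "W 0 = partial i (partial j u)" by (simp add: W_def heat_0 LW_def u partial_trig_poly)
  have FW [simp, intro]: "trig (F t)" "trig (W t)" for t by (auto simp: F_def W_def)
  \<comment> \<open>All operators involved are multipliers, so the relation between the Hessian
    entry and the Laplacian of \<open>u\<close> is preserved by the flow.\<close>
  have rel: "laplacian (W t) = partial i (partial j (F t))" for t
    unfolding F_def W_def laplacian_trig_poly partial_trig_poly heat_multiplier LF_def LW_def
    by (simp add: multiplier_multiplier mult_ac)
  define psi where "psi t x = F t x ^ 2 * W t x ^ 2 - W t x ^ 4 / 12 + 4 / 3 * F t x ^ 4" for t x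
  \<comment> \<open>The time derivative of \<open>psi\<close>, with the heat equation inserted and
    arranged as in \<open>dissipation\<close>.\<close>
  define psi' where "psi' t x = 2 * F t x * W t x ^ 2 * laplacian (F t) x + 2 * F t x ^ 2 * W t x * laplacian (W t) x
      - W t x ^ 3 * laplacian (W t) x / 3 + 16 / 3 * F t x ^ 3 * laplacian (F t) x" for t x
  have psi_trig: "trig (psi t)" for t
    unfolding psi_def by simp
  have psi'_trig: "trig (psi' t)" for t
    unfolding psi'_def by simp
  have dpsi: "((\<lambda>t. psi t x) has_real_derivative psi' t x) (at t)" for t x
  proof -
    have F: "((\<lambda>t. F t x) has_real_derivative laplacian (F t) x) (at t)"
      and W: "((\<lambda>t. W t x) has_real_derivative laplacian (W t) x) (at t)"
      unfolding F_def W_def by (rule heat_has_derivative)+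
    show ?thesis unfolding psi_def psi'_def
      by (rule DERIV_cong, (rule DERIV_add DERIV_diff DERIV_mult DERIV_cdivide DERIV_cmult DERIV_power F W)+)
        (simp add: algebra_simps power2_eq_square power3_eq_cube)
  qed
  have "continuous_on UNIV (\<lambda>(t, x). psi' t x)"
    using continuous_heat[of LF] continuous_heat[of LW]
      continuous_heat[of "multiplier (\<lambda>k. - of_real ((norm (freq k))\<^sup>2)) LF"]
      continuous_heat[of "multiplier (\<lambda>k. - of_real ((norm (freq k))\<^sup>2)) LW"]
    unfolding psi'_def F_def W_def laplacian_trig_poly heat_multiplier split_def
    by (intro continuous_intros) auto
  then have "((\<lambda>t. integral (cbox 0 1) (psi t)) has_field_derivative integral (cbox 0 1) (psi' t)) (at t within UNIV)" for t
    by (intro leibniz_rule_field_derivative)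
      (auto simp: dpsi intro: continuous_on_subset integrable_continuous trig_continuous psi_trig)
  then have d: "((\<lambda>t. \<integral>x. psi t x \<partial>T3) has_real_derivative (\<integral>x. psi' t x \<partial>T3)) (at t)" for t
    using T3_continuous(2)[OF trig_continuous[OF psi_trig]] T3_continuous(2)[OF trig_continuous[OF psi'_trig]]
    by (simp add: cube3_def)
  have neg: "(\<integral>x. psi' t x \<partial>T3) \<le> 0" for t
    unfolding psi'_def by (rule dissipation[OF FW rel])
  have mono: "(\<integral>x. psi t x \<partial>T3) \<le> (\<integral>x. psi 0 x \<partial>T3)" if "t \<ge> 0" for t
    by (rule DERIV_nonpos_imp_nonincreasing[OF that]) (use d neg in blast)
  \<comment> \<open>A second derivative has no constant mode, so \<open>W\<close> decays uniformly
    in space.\<close>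
  have "\<forall>(a, k) \<in> set LW. k = 0 \<longrightarrow> a = 0"
    by (auto simp: LW_def multiplier_def D_symbol_def)
  from heat_decay[OF this] obtain M where "\<forall>t\<ge>0. \<forall>x. \<bar>trig_poly (heat t LW) x\<bar> \<le> M * exp (- t)" ..
  then have M: "\<bar>W t x\<bar> \<le> M * exp (- t)" if "t \<ge> 0" for t x
    using that by (simp add: W_def)
  \<comment> \<open>\<open>W^4\<close> is the only term of \<open>psi\<close> with a negative sign,
    so the decay of \<open>W\<close> bounds the integral at time \<open>t\<close>, and by
    monotonicity the one at time \<open>0\<close>, from below.\<close>
  have low: "- ((M * exp (- t)) ^ 4 / 12) \<le> (\<integral>x. psi 0 x \<partial>T3)" if "t \<ge> 0" for t
  proof -
    have "- ((M * exp (- t)) ^ 4 / 12) = (\<integral>x. - ((M * exp (- t)) ^ 4 / 12) \<partial>T3)"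
      by (simp add: measure_T3)
    also have "\<dots> \<le> (\<integral>x. psi t x \<partial>T3)"
    proof (rule integral_mono)
      fix x
      have "W t x ^ 4 \<le> (M * exp (- t)) ^ 4"
        using power_mono[OF M[OF that, of x], of 4] by simp
      moreover have "0 \<le> F t x ^ 2 * W t x ^ 2" "0 \<le> F t x ^ 4" by simp_all
      ultimately show "- ((M * exp (- t)) ^ 4 / 12) \<le> psi t x" unfolding psi_def by linarith
    qed (simp_all add: psi_trig)
    also have "\<dots> \<le> (\<integral>x. psi 0 x \<partial>T3)" by (rule mono[OF that])
    finally show ?thesis .
  qed
  have "((\<lambda>t. - ((M * exp (- t)) ^ 4 / 12)) \<longlongrightarrow> - ((M * 0) ^ 4 / 12)) at_top"
    by (intro tendsto_intros) (simp_all add: filterlim_compose[OF exp_at_bot filterlim_uminus_at_bot_at_top])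
  then have "- ((M * 0) ^ 4 / 12) \<le> (\<integral>x. psi 0 x \<partial>T3)"
    by (rule tendsto_upperbound) (auto simp: eventually_at_top_linorder intro!: exI[of _ 0] low)
  then have "0 \<le> (\<integral>x. psi 0 x \<partial>T3)" by simp
  also have "\<dots> \<le> (\<integral>x. 22/3 * F 0 x ^ 4 - (1/24) * W 0 x ^ 4 \<partial>T3)"
  proof (rule integral_mono)
    fix x
    \<comment> \<open>This is \<open>F^2 W^2 \<le> 6 F^4 + W^4 / 24\<close>, which uses up half of
      \<open>W^4 / 12\<close>. Then \<open>6 + 4/3 = 22/3\<close>, and
      \<open>24 * 22/3 = 176\<close> is the constant of the lemma.\<close>
    have "0 \<le> (12 * F 0 x ^ 2 - W 0 x ^ 2)\<^sup>2 / 24" by simp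
    also have "\<dots> = 6 * F 0 x ^ 4 - F 0 x ^ 2 * W 0 x ^ 2 + W 0 x ^ 4 / 24"
      by (simp add: power2_eq_square eval_nat_numeral field_simps)
    finally show "psi 0 x \<le> 22/3 * F 0 x ^ 4 - (1/24) * W 0 x ^ 4" by (simp add: psi_def)
  qed (simp_all add: psi_trig)
  also have "\<dots> = 22/3 * (\<integral>x. F 0 x ^ 4 \<partial>T3) - (1/24) * (\<integral>x. W 0 x ^ 4 \<partial>T3)"
    by (subst Bochner_Integration.integral_diff, simp, simp) (simp only: integral_mult_right_zero)
  finally show ?thesis unfolding F0 W0 by simp
qed

subsection \<open>The resolvent equation\<close>

lemma fourth_power_add_le: "(a + b) ^ 4 \<le> 8 * (a ^ 4 + b ^ 4)" for a b :: real
proof -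
  have "(a + b)\<^sup>2 \<le> 2 * (a\<^sup>2 + b\<^sup>2)"
    using sum_squares_bound[of a b] by (simp add: power2_sum)
  then have "((a + b)\<^sup>2)\<^sup>2 \<le> (2 * (a\<^sup>2 + b\<^sup>2))\<^sup>2" by (rule power_mono) simp
  also have "\<dots> \<le> 8 * ((a\<^sup>2)\<^sup>2 + (b\<^sup>2)\<^sup>2)"
    using sum_squares_bound[of "a\<^sup>2" "b\<^sup>2"] by (simp add: power2_sum power_mult_distrib)
  finally show ?thesis by (simp flip: power_mult)
qed

text \<open>Young's inequality with exponents \<open>4/3\<close> and \<open>4\<close>. It holds for
  all signs because the difference is a sum of squares.\<close>

lemma Young_cubic: "a ^ 3 * b \<le> 3 / 4 * a ^ 4 + b ^ 4 / 4" for a b :: real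
proof -
  have "4 * (3 / 4 * a ^ 4 + b ^ 4 / 4 - a ^ 3 * b) = (a\<^sup>2 - b\<^sup>2)\<^sup>2 + 2 * a\<^sup>2 * (a - b)\<^sup>2"
    by (simp add: power2_eq_square eval_nat_numeral algebra_simps)
  also have "\<dots> \<ge> 0" by simp
  finally show ?thesis by simp
qed

text \<open>The symbol \<open>1 + |freq k|^2\<close> of identity minus Laplacian never vanishes.
  Unlike the Poisson equation, this equation is thus solvable for every trigonometric right-hand
  side, constants included.\<close>

lemma resolvent:
  assumes "trig f"
  obtains u where "trig u" "\<And>x. f x = u x - laplacian u x"
proof -
  obtain L where L: "f = trig_poly L" using assms by (auto simp: trig_def)
  define u where "u = trig_poly (multiplier (\<lambda>k. of_real (1 / (1 + (norm (freq k))\<^sup>2))) L)"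
  have 1: "of_real (1 / (1 + (norm (freq k))\<^sup>2)) + (of_real ((norm (freq k))\<^sup>2) * of_real (1 / (1 + (norm (freq k))\<^sup>2))) = (1::complex)" for k
  proof -
    have "1 / (1 + (norm (freq k))\<^sup>2) + (norm (freq k))\<^sup>2 * (1 / (1 + (norm (freq k))\<^sup>2)) = 1"
      by (simp add: add_nonneg_eq_0_iff flip: add_divide_distrib)
    then show ?thesis by (metis of_real_1 of_real_add of_real_mult)
  qed
  have "u x - laplacian u x = f x" for x
  proof -
    have "f x = trig_poly (multiplier (\<lambda>k. of_real (1 / (1 + (norm (freq k))\<^sup>2)) + (of_real ((norm (freq k))\<^sup>2) * of_real (1 / (1 + (norm (freq k))\<^sup>2)))) L) x"
      unfolding 1 by (simp add: L multiplier_one)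
    also have "\<dots> = u x + trig_poly (multiplier (\<lambda>k. of_real ((norm (freq k))\<^sup>2) * of_real (1 / (1 + (norm (freq k))\<^sup>2))) L) x"
      unfolding trig_poly_multiplier_add u_def ..
    also have "trig_poly (multiplier (\<lambda>k. of_real ((norm (freq k))\<^sup>2) * of_real (1 / (1 + (norm (freq k))\<^sup>2))) L) x = - laplacian u x"
      using trig_poly_multiplier_scale[of "-1" "\<lambda>k. of_real ((norm (freq k))\<^sup>2) * of_real (1 / (1 + (norm (freq k))\<^sup>2))" L x]
      unfolding u_def laplacian_trig_poly multiplier_multiplier
      by simp
    finally show ?thesis by simp
  qed
  then show thesis using that[of u] by (simp add: u_def)
qed

text \<open>Test the equation with \<open>u^3\<close>: the Laplacian contributes with a favourable
  sign, and Young's inequality for \<open>u^3 f\<close> lets \<open>3/4\<close> of the left-hand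
  side be absorbed.\<close>

lemma resolvent_estimate:
  assumes u: "trig u" and f: "\<And>x. f x = u x - laplacian u x"
  shows "(\<integral>x. u x ^ 4 \<partial>T3) \<le> (\<integral>x. f x ^ 4 \<partial>T3)"
proof -
  note [simp] = u
  have fe: "f = (\<lambda>x. u x - laplacian u x)" using f by auto
  then have [simp]: "trig f" by simp
  have "(\<integral>x. u x ^ 3 * laplacian u x \<partial>T3) = - (\<integral>x. (\<Sum>l\<in>UNIV. 3 * u x ^ 2 * partial l u x * partial l u x) \<partial>T3)"
    by (subst integral_laplacian_by_parts) (simp_all add: partial_cubic(2)[OF u u])
  also have "\<dots> \<le> 0"
    by (simp add: sum_nonneg mult.assoc)
  finally have "(\<integral>x. u x ^ 4 \<partial>T3) \<le> (\<integral>x. u x ^ 4 \<partial>T3) - (\<integral>x. u x ^ 3 * laplacian u x \<partial>T3)" by simp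
  also have "\<dots> = (\<integral>x. u x ^ 3 * f x \<partial>T3)"
    by (subst Bochner_Integration.integral_diff[symmetric])
      (simp_all add: fe algebra_simps power_Suc[symmetric] del: power_Suc)
  also have "\<dots> \<le> (\<integral>x. 3 / 4 * u x ^ 4 + f x ^ 4 / 4 \<partial>T3)"
    by (intro integral_mono Young_cubic) simp_all
  also have "\<dots> = 3 / 4 * (\<integral>x. u x ^ 4 \<partial>T3) + (\<integral>x. f x ^ 4 \<partial>T3) / 4"
    by (subst Bochner_Integration.integral_add, simp, simp) simp
  finally show ?thesis by simp
qed

lemma gradient_estimate:
  assumes u: "trig u"
  shows "(\<integral>x. partial i u x ^ 4 \<partial>T3) \<le> 9 / 2 * ((\<integral>x. u x ^ 4 \<partial>T3) + (\<integral>x. partial i (partial i u) x ^ 4 \<partial>T3))"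
proof -
  note [simp] = u
  have "(\<integral>x. partial i u x ^ 4 \<partial>T3) = (\<integral>x. partial i u x ^ 3 * partial i u x \<partial>T3)"
    by (simp add: eval_nat_numeral mult_ac)
  also have "\<dots> = - (\<integral>x. 3 * partial i u x ^ 2 * partial i (partial i u) x * u x \<partial>T3)"
    by (subst integral_by_parts) (simp_all add: partial_cubic(2)[OF trig_partial[OF u] trig_partial[OF u]])
  also have "\<dots> = (\<integral>x. - (3 * partial i u x ^ 2 * partial i (partial i u) x * u x) \<partial>T3)"
    by simp
  also have "\<dots> \<le> (\<integral>x. (1/2) * partial i u x ^ 4 + (9/4) * (u x ^ 4 + partial i (partial i u) x ^ 4) \<partial>T3)"
  proof (rule integral_mono)
    fix x
    define p q r where "p = partial i u x" and "q = partial i (partial i u) x" and "r = u x"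
    \<comment> \<open>Two completed squares leave \<open>p^4\<close> with coefficient
      \<open>1/2\<close>. Absorbing it doubles \<open>9/4\<close> to the \<open>9/2\<close> of the
      statement.\<close>
    have "0 \<le> (p\<^sup>2 + 3 * (q * r))\<^sup>2 / 2 + 9/4 * (q\<^sup>2 - r\<^sup>2)\<^sup>2" by simp
    also have "\<dots> = (1/2) * p ^ 4 + (9/4) * (r ^ 4 + q ^ 4) - - (3 * p ^ 2 * q * r)"
      by (simp add: power2_eq_square eval_nat_numeral field_simps)
    finally show "- (3 * p ^ 2 * q * r) \<le> (1/2) * p ^ 4 + (9/4) * (r ^ 4 + q ^ 4)" by linarith
  qed simp_all
  also have "\<dots> = (1/2) * (\<integral>x. partial i u x ^ 4 \<partial>T3) + (9/4) * ((\<integral>x. u x ^ 4 \<partial>T3) + (\<integral>x. partial i (partial i u) x ^ 4 \<partial>T3))"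
    by (subst Bochner_Integration.integral_add, simp, simp)+
      (simp only: integral_mult_right_zero, subst Bochner_Integration.integral_add, simp_all)
  finally show ?thesis by linarith
qed

text \<open>From \<open>laplacian u = u - f\<close> the Laplacian costs a factor \<open>16\<close>.
  This gives \<open>176 * 16 = 2816\<close> for second derivatives and \<open>9/2 * 2817\<close> for
  first ones; \<open>20000\<close> is a common round bound.\<close>

lemma resolvent_derivative_estimates:
  assumes u: "trig u" and f: "\<And>x. f x = u x - laplacian u x"
  shows "(\<integral>x. partial i (partial j u) x ^ 4 \<partial>T3) \<le> 20000 * (\<integral>x. f x ^ 4 \<partial>T3)"
    and "(\<integral>x. partial i u x ^ 4 \<partial>T3) \<le> 20000 * (\<integral>x. f x ^ 4 \<partial>T3)"
proof -
  note [simp] = u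
  have fe: "f = (\<lambda>x. u x - laplacian u x)" using f by auto
  then have [simp]: "trig f" by simp
  have u4: "(\<integral>x. u x ^ 4 \<partial>T3) \<le> (\<integral>x. f x ^ 4 \<partial>T3)"
    using resolvent_estimate[OF assms] .
  have "(\<integral>x. laplacian u x ^ 4 \<partial>T3) \<le> (\<integral>x. 8 * (u x ^ 4 + f x ^ 4) \<partial>T3)"
  proof (rule integral_mono)
    show "laplacian u x ^ 4 \<le> 8 * (u x ^ 4 + f x ^ 4)" for x
    proof -
      have "u x + - f x = laplacian u x" by (simp add: f)
      then show ?thesis using fourth_power_add_le[of "u x" "- f x"] by simp
    qed
  qed simp_all
  also have "\<dots> = 8 * ((\<integral>x. u x ^ 4 \<partial>T3) + (\<integral>x. f x ^ 4 \<partial>T3))"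
    by simp
  finally have lap4: "(\<integral>x. laplacian u x ^ 4 \<partial>T3) \<le> 16 * (\<integral>x. f x ^ 4 \<partial>T3)" using u4 by simp
  have f0: "0 \<le> (\<integral>x. f x ^ 4 \<partial>T3)" by simp
  have h: "(\<integral>x. partial i (partial j u) x ^ 4 \<partial>T3) \<le> 2816 * (\<integral>x. f x ^ 4 \<partial>T3)" for i j
    using hessian_estimate[OF u, of i j] lap4 by simp
  show "(\<integral>x. partial i (partial j u) x ^ 4 \<partial>T3) \<le> 20000 * (\<integral>x. f x ^ 4 \<partial>T3)"
    using h[of i j] f0 by linarith
  show "(\<integral>x. partial i u x ^ 4 \<partial>T3) \<le> 20000 * (\<integral>x. f x ^ 4 \<partial>T3)"
  proof -
    have "(\<integral>x. partial i u x ^ 4 \<partial>T3) \<le> 9 / 2 * ((\<integral>x. f x ^ 4 \<partial>T3) + 2816 * (\<integral>x. f x ^ 4 \<partial>T3))"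
      by (rule order_trans[OF gradient_estimate[OF u]]) (intro mult_left_mono add_mono u4 h, simp)
    also have "\<dots> = 25353 / 2 * (\<integral>x. f x ^ 4 \<partial>T3)" by simp
    also have "\<dots> \<le> 20000 * (\<integral>x. f x ^ 4 \<partial>T3)"
      using f0 by (intro mult_right_mono) simp_all
    finally show ?thesis .
  qed
qed

subsection \<open>Density of trigonometric polynomials\<close>

text \<open>The torus as a product of three unit circles. Its image is a compact subset of a
  Euclidean space, where Stone-Weierstrass applies, and polynomials pull back to trigonometric
  polynomials.\<close>

definition circle_map :: "real^3 \<Rightarrow> complex^3" where
  "circle_map x = (\<chi> i. cis (2 * pi * x $ i))"

lemma continuous_circle_map: "continuous_on S circle_map"
  unfolding circle_map_def cis_conv_exp by (intro continuous_intros)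

text \<open>On the closed cube the map identifies only boundary points, because coordinates in
  \<open>[0,1]\<close> with equal image differ by \<open>0\<close>, \<open>1\<close> or
  \<open>-1\<close>. A function that vanishes on the boundary therefore descends to the
  image.\<close>

lemma circle_map_eq:
  assumes eq: "circle_map x = circle_map y" and xy: "x \<in> cube3" "y \<in> cube3"
  shows "x = y \<or> (x \<notin> box 0 1 \<and> y \<notin> box 0 1)"
proof (cases "x = y")
  case False
  then obtain i where i: "x $ i \<noteq> y $ i" by (auto simp: vec_eq_iff)
  have "cis (2 * pi * x $ i) = cis (2 * pi * y $ i)"
    using eq by (simp add: circle_map_def vec_eq_iff)
  then have "sin (2 * pi * x $ i) = sin (2 * pi * y $ i) \<and> cos (2 * pi * x $ i) = cos (2 * pi * y $ i)"
    by (simp add: complex_eq_iff)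
  then obtain n :: int where n: "2 * pi * x $ i = 2 * pi * y $ i + 2 * pi * n"
    unfolding sin_cos_eq_iff by blast
  then have "2 * pi * x $ i = 2 * pi * (y $ i + n)" by (simp add: algebra_simps)
  then have "x $ i = y $ i + n" by simp
  moreover have "0 \<le> x $ i" "x $ i \<le> 1" "0 \<le> y $ i" "y $ i \<le> 1"
    using xy by (auto simp: cube3_def mem_box_cart)
  ultimately have "n = 1 \<or> n = -1" using i by (cases "n = 0"; linarith)
  with \<open>x $ i = y $ i + n\<close> have "(x $ i = 1 \<and> y $ i = 0) \<or> (x $ i = 0 \<and> y $ i = 1)"
    using \<open>0 \<le> x $ i\<close> \<open>x $ i \<le> 1\<close> \<open>0 \<le> y $ i\<close> \<open>y $ i \<le> 1\<close> by auto
  then have "\<not> (0 < x $ i \<and> x $ i < 1)" "\<not> (0 < y $ i \<and> y $ i < 1)" by auto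
  then show ?thesis by (auto simp: mem_box_cart)
qed simp

text \<open>Base case of the induction over real polynomial functions: the real coordinates of
  \<open>circle_map\<close> are cosines and sines, that is, waves with amplitudes \<open>1\<close>
  and \<open>- \<i>\<close>.\<close>

lemma trig_circle_map_linear:
  fixes f :: "complex^3 \<Rightarrow> real"
  assumes "bounded_linear f"
  shows "trig (\<lambda>x. f (circle_map x))"
proof -
  have lin: "linear f" using assms by (rule bounded_linear.linear)
  have coord: "trig (\<lambda>x. circle_map x \<bullet> b)" if b0: "b \<in> Basis" for b
  proof -
    obtain i c where b: "b = axis i c" "c = 1 \<or> c = \<i>"
      using b0 unfolding Basis_vec_def Basis_complex_def by blast
    have f: "freq (axis i 1) \<bullet> x = 2 * pi * x $ i" for x
    proof -
      have "freq (axis i 1) = axis i (2 * pi)" by (simp add: freq_def axis_def vec_eq_iff)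
      then show ?thesis by (simp add: inner_axis')
    qed
    show ?thesis using b(2)
    proof
      assume c: "c = 1"
      have "circle_map x \<bullet> b = wave 1 (axis i 1) x" for x
        by (simp add: b c inner_axis circle_map_def wave_def f inner_complex_def)
      then show ?thesis by (simp add: trig_wave)
    next
      assume c: "c = \<i>"
      have "circle_map x \<bullet> b = wave (- \<i>) (axis i 1) x" for x
        by (simp add: b c inner_axis circle_map_def wave_def f inner_complex_def)
      then show ?thesis by (simp add: trig_wave)
    qed
  qed
  have "f (circle_map x) = (\<Sum>b\<in>Basis. (circle_map x \<bullet> b) * f b)" for x
  proof -
    have "f (circle_map x) = f (\<Sum>b\<in>Basis. (circle_map x \<bullet> b) *\<^sub>R b)"
      by (simp add: euclidean_representation)
    then show ?thesis using lin by (simp add: linear_sum linear_scale)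
  qed
  then show ?thesis using coord by simp
qed

lemma trig_circle_map_polynomial:
  fixes f :: "complex^3 \<Rightarrow> real"
  assumes "real_polynomial_function f"
  shows "trig (\<lambda>x. f (circle_map x))"
  using assms by induction (simp_all add: trig_circle_map_linear)

lemma trig_approx_uniform:
  fixes g :: "real^3 \<Rightarrow> real"
  assumes cont: "continuous_on cube3 g" and bdry: "\<And>x. x \<notin> box 0 1 \<Longrightarrow> g x = 0" and e: "e > 0"
  obtains p where "trig p" "\<And>x. x \<in> cube3 \<Longrightarrow> \<bar>g x - p x\<bar> < e"
proof -
  \<comment> \<open>The choice of preimage is harmless: distinct preimages in the cube lie on its
    boundary, where \<open>g\<close> is \<open>0\<close>.\<close>
  define F where "F z = g (SOME x. x \<in> cube3 \<and> circle_map x = z)" for z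
  have F: "F (circle_map x) = g x" if "x \<in> cube3" for x
  proof -
    define y where "y = (SOME y. y \<in> cube3 \<and> circle_map y = circle_map x)"
    have "y \<in> cube3 \<and> circle_map y = circle_map x"
      unfolding y_def by (rule someI[of _ x]) (use that in simp)
    then have "g y = g x" using circle_map_eq[of y x] that bdry by auto
    then show ?thesis by (simp add: F_def y_def)
  qed
  have comp: "compact cube3" by (simp add: cube3_def)
  then have K: "compact (circle_map ` cube3)"
    by (intro compact_continuous_image continuous_circle_map)
  \<comment> \<open>\<open>circle_map\<close> acts as a quotient map on the compact cube: the
    preimage of a closed set under \<open>F\<close> is the continuous image of a compact
    set.\<close>
  have "closed (F -` T \<inter> circle_map ` cube3)" if "closed T" for T
  proof -
    have "F -` T \<inter> circle_map ` cube3 = circle_map ` (g -` T \<inter> cube3)"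
      using F by auto
    moreover have "closed (g -` T \<inter> cube3)"
      using continuous_on_closed_vimage[OF compact_imp_closed[OF comp], of g] cont that by blast
    then have "compact (g -` T \<inter> cube3)"
      using comp by (meson bounded_subset compact_eq_bounded_closed inf_le2)
    ultimately show ?thesis
      by (metis compact_continuous_image compact_imp_closed continuous_circle_map)
  qed
  then have "continuous_on (circle_map ` cube3) F"
    using continuous_on_closed_vimage[OF compact_imp_closed[OF K]] by blast
  from Stone_Weierstrass_real_polynomial_function[OF K this e]
  obtain P where P: "real_polynomial_function P" "\<And>z. z \<in> circle_map ` cube3 \<Longrightarrow> \<bar>F z - P z\<bar> < e" by blast
  show thesis
  proof (rule that)
    show "trig (\<lambda>x. P (circle_map x))" by (rule trig_circle_map_polynomial[OF P(1)])
    show "\<bar>g x - P (circle_map x)\<bar> < e" if "x \<in> cube3" for x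
      using P(2)[of "circle_map x"] that by (simp add: F)
  qed
qed

section \<open>From uniform approximation to approximation in the fourth-power mean\<close>

lemma sets_T3 [measurable]: "cube3 \<in> sets lebesgue"
  by (simp add: cube3_def)

lemma space_T3 [simp]: "space T3 = cube3"
  by (simp add: T3_def)

lemma AE_T3_negligible:
  assumes "negligible N" and "\<And>x. x \<in> cube3 \<Longrightarrow> x \<notin> N \<Longrightarrow> P x"
  shows "AE x in T3. P x"
proof -
  have "AE x in lebesgue. x \<in> cube3 \<longrightarrow> P x"
    using assms by (intro AE_I'[of N]) (auto simp: negligible_iff_null_sets)
  then show ?thesis unfolding T3_def by (subst AE_restrict_space_iff) (auto simp: sets_T3)
qed

lemma finite_measure_T3: "finite_measure T3"
proof
  show "emeasure T3 (space T3) \<noteq> \<infinity>"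
    using emeasure_lborel_cbox_finite[of "0::real^3" 1]
    by (simp add: T3_def emeasure_restrict_space cube3_def)
qed

lemma integrable_T3_const [simp]: "integrable T3 (\<lambda>x. c::real)"
  using finite_measure.integrable_const[OF finite_measure_T3] .

lemma trig_measurable [measurable]: "trig p \<Longrightarrow> p \<in> borel_measurable T3"
  using borel_measurable_integrable trig_integrable by blast

lemma L4_distance_less_of_tendsto_AE:
  fixes f :: "real^3 \<Rightarrow> real" and h :: "nat \<Rightarrow> real^3 \<Rightarrow> real"
  assumes [measurable]: "f \<in> borel_measurable T3" "\<And>n. h n \<in> borel_measurable T3"
    and lim: "AE x in T3. (\<lambda>n. h n x) \<longlonglongrightarrow> f x"
    and w: "integrable T3 w" and bd: "\<And>n. AE x in T3. (f x - h n x) ^ 4 \<le> w x" and e: "e > 0"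
  shows "\<exists>n. integrable T3 (\<lambda>x. (f x - h n x) ^ 4) \<and> (\<integral>x. (f x - h n x) ^ 4 \<partial>T3) < e"
proof -
  have l: "AE x in T3. (\<lambda>n. (f x - h n x) ^ 4) \<longlonglongrightarrow> 0"
    using lim
  proof eventually_elim
    case (elim x)
    have "(\<lambda>n. (f x - h n x) ^ 4) \<longlonglongrightarrow> (f x - f x) ^ 4" by (intro tendsto_intros elim)
    then show ?case by simp
  qed
  have "(\<lambda>n. \<integral>x. (f x - h n x) ^ 4 \<partial>T3) \<longlonglongrightarrow> (\<integral>x. 0 \<partial>T3)"
    by (rule integral_dominated_convergence[where w = w]) (use l w bd in auto)
  then have "eventually (\<lambda>n. (\<integral>x. (f x - h n x) ^ 4 \<partial>T3) < e) sequentially"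
    using e by (intro order_tendstoD) auto
  then obtain n where "(\<integral>x. (f x - h n x) ^ 4 \<partial>T3) < e"
    by (auto simp: eventually_sequentially)
  moreover have "integrable T3 (\<lambda>x. (f x - h n x) ^ 4)"
    by (rule Bochner_Integration.integrable_bound[OF w]) (use bd[of n] in auto)
  ultimately show ?thesis by blast
qed

text \<open>The truncation error never exceeds \<open>|f|\<close>, so \<open>f^4\<close> serves as
  dominating function.\<close>

lemma truncate_approx:
  fixes f :: "real^3 \<Rightarrow> real"
  assumes [measurable]: "f \<in> borel_measurable T3" and int: "integrable T3 (\<lambda>x. f x ^ 4)" and e: "e > 0"
  shows "\<exists>n::nat. integrable T3 (\<lambda>x. (f x - max (- n) (min n (f x))) ^ 4)
    \<and> (\<integral>x. (f x - max (- n) (min n (f x))) ^ 4 \<partial>T3) < e"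
proof (rule L4_distance_less_of_tendsto_AE[OF _ _ _ int _ e])
  show "AE x in T3. (\<lambda>n. max (- real n) (min (real n) (f x))) \<longlonglongrightarrow> f x"
  proof (rule AE_I2)
    fix x
    obtain N :: nat where "\<bar>f x\<bar> \<le> N" using real_arch_simple by blast
    then have "\<forall>n\<ge>N. max (- real n) (min (real n) (f x)) = f x" by (auto simp: max_def min_def)
    then show "(\<lambda>n. max (- real n) (min (real n) (f x))) \<longlonglongrightarrow> f x"
      by (intro tendsto_eventually) (auto simp: eventually_sequentially)
  qed
  show "AE x in T3. (f x - max (- real n) (min (real n) (f x))) ^ 4 \<le> f x ^ 4" for n
  proof (rule AE_I2)
    fix x
    have "\<bar>f x - max (- real n) (min (real n) (f x))\<bar> \<le> \<bar>f x\<bar>" by (auto simp: max_def min_def)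
    then show "(f x - max (- real n) (min (real n) (f x))) ^ 4 \<le> f x ^ 4"
      using power_mono[of "\<bar>f x - max (- real n) (min (real n) (f x))\<bar>" "\<bar>f x\<bar>" 4] by simp
  qed
qed measurable

lemma bounded_approx:
  fixes f :: "real^3 \<Rightarrow> real"
  assumes [measurable]: "f \<in> borel_measurable T3" and bd: "\<And>x. \<bar>f x\<bar> \<le> M" and e: "e > 0"
  shows "\<exists>h. continuous_on UNIV h \<and> (\<forall>x. x \<notin> box 0 1 \<longrightarrow> h x = 0)
    \<and> integrable T3 (\<lambda>x. (f x - h x) ^ 4) \<and> (\<integral>x. (f x - h x) ^ 4 \<partial>T3) < e"
proof -
  have M: "0 \<le> M" using bd[of 0] by linarith
  have "f measurable_on cube3"
    using assms(1) measurable_on_iff_borel_measurable[OF sets_T3, of f] unfolding T3_def by blast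
  then obtain N g where N: "negligible N" and g: "\<And>n::nat. continuous_on UNIV (g n)"
    and gl: "\<And>x. x \<notin> N \<Longrightarrow> (\<lambda>n. g n x) \<longlonglongrightarrow> (if x \<in> cube3 then f x else 0)"
    unfolding measurable_on_def by blast
  define C :: "(real^3) set" where "C = - box 0 1"
  \<comment> \<open>The first factor is a cutoff that is \<open>0\<close> off the open cube and
    tends to \<open>1\<close> inside it. Clipping at \<open>M\<close> provides the constant
    dominating function for bounded convergence.\<close>
  define h where "h n x = min 1 (real n * infdist x C) * max (- M) (min M (g n x))" for n x
  have hc: "continuous_on UNIV (h n)" for n
    unfolding h_def by (intro continuous_intros g)
  have "0 \<in> C" by (simp add: C_def mem_box_cart)
  then have C: "closed C" "C \<noteq> {}" by (auto simp: C_def closed_Compl)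
  have hb: "h n x = 0" if "x \<notin> box 0 1" for n x
    using that by (simp add: h_def C_def)
  have "\<exists>n. integrable T3 (\<lambda>x. (f x - h n x) ^ 4) \<and> (\<integral>x. (f x - h n x) ^ 4 \<partial>T3) < e"
  proof (rule L4_distance_less_of_tendsto_AE[OF _ _ _ integrable_T3_const[of "(2 * M) ^ 4"] _ e])
    show "h n \<in> borel_measurable T3" for n
      using T3_continuous(1) hc by (meson borel_measurable_integrable continuous_on_subset subset_UNIV)
    have "negligible (N \<union> (cube3 - box 0 1))"
      using N negligible_frontier_interval[of 0 "1::real^3"] by (simp add: cube3_def)
    then show "AE x in T3. (\<lambda>n. h n x) \<longlonglongrightarrow> f x"
    proof (rule AE_T3_negligible)
      fix x assume x: "x \<in> cube3" "x \<notin> N \<union> (cube3 - box 0 1)"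
      then have "x \<notin> C" by (auto simp: C_def)
      then have pos: "infdist x C > 0" using C infdist_pos_not_in_closed by blast
      obtain n0 :: nat where n0: "1 < real n0 * infdist x C" using pos reals_Archimedean3 by blast
      have "1 \<le> real n * infdist x C" if "n \<ge> n0" for n
      proof -
        have "real n0 * infdist x C \<le> real n * infdist x C"
          using that pos by (intro mult_right_mono) auto
        then show ?thesis using n0 by linarith
      qed
      then have 1: "(\<lambda>n. min 1 (real n * infdist x C)) \<longlonglongrightarrow> 1"
        by (intro tendsto_eventually) (auto simp: eventually_sequentially intro!: exI[of _ n0])
      have "(\<lambda>n. max (- M) (min M (g n x))) \<longlonglongrightarrow> max (- M) (min M (f x))"
        using gl[of x] x by (intro tendsto_intros) auto
      moreover have "max (- M) (min M (f x)) = f x" using bd[of x] by (auto simp: max_def min_def)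
      ultimately show "(\<lambda>n. h n x) \<longlonglongrightarrow> f x"
        unfolding h_def using tendsto_mult[OF 1] by simp
    qed
    show "AE x in T3. (f x - h n x) ^ 4 \<le> (2 * M) ^ 4" for n
    proof (rule AE_I2)
      fix x
      have "\<bar>h n x\<bar> \<le> 1 * M"
        unfolding h_def abs_mult using M infdist_nonneg[of x C] by (intro mult_mono) (auto simp: max_def min_def)
      then have "\<bar>f x - h n x\<bar> \<le> 2 * M" using bd[of x] by linarith
      then show "(f x - h n x) ^ 4 \<le> (2 * M) ^ 4"
        using power_mono[of "\<bar>f x - h n x\<bar>" "2 * M" 4] by simp
    qed
  qed measurable
  then show ?thesis using hc hb by blast
qed

lemma trig_dense_L4:
  assumes [measurable]: "f \<in> borel_measurable T3" and int: "integrable T3 (\<lambda>x. f x ^ 4)" and e: "e > 0"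
  obtains p where "trig p" "integrable T3 (\<lambda>x. (f x - p x) ^ 4)" "(\<integral>x. (f x - p x) ^ 4 \<partial>T3) < e"
proof -
  \<comment> \<open>Two uses of \<open>fourth_power_add_le\<close> cost at most a factor
    \<open>64\<close>; three errors of size at most \<open>d\<close> then give less than
    \<open>192 * d\<close>, which is below \<open>256 * d = e\<close>.\<close>
  define d where "d = e / 256"
  have d: "d > 0" using e by (simp add: d_def)
  from truncate_approx[OF assms(1) int d]
  obtain n :: nat where n: "integrable T3 (\<lambda>x. (f x - max (- real n) (min (real n) (f x))) ^ 4)"
    "(\<integral>x. (f x - max (- real n) (min (real n) (f x))) ^ 4 \<partial>T3) < d"
    by (elim exE conjE) (rule that)
  define g where "g x = max (- real n) (min (real n) (f x))" for x
  have [measurable]: "g \<in> borel_measurable T3" unfolding g_def by measurable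
  have gn: "\<bar>g x\<bar> \<le> n" for x by (auto simp: g_def max_def min_def)
  from bounded_approx[OF \<open>g \<in> borel_measurable T3\<close> gn d]
  obtain h where hc: "continuous_on UNIV h" and hb: "\<forall>x. x \<notin> box 0 1 \<longrightarrow> h x = 0"
    and h: "integrable T3 (\<lambda>x. (g x - h x) ^ 4)" "(\<integral>x. (g x - h x) ^ 4 \<partial>T3) < d"
    by (elim exE conjE) (rule that)
  have hc': "continuous_on cube3 h" using hc continuous_on_subset by blast
  then have [measurable]: "h \<in> borel_measurable T3"
    using T3_continuous(1) borel_measurable_integrable by blast
  \<comment> \<open>A uniform error below both \<open>1\<close> and \<open>d\<close> has a fourth
    power below \<open>d\<close>.\<close>
  have "min 1 d > 0" using d by simp
  from trig_approx_uniform[OF hc' hb[rule_format] this]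
  obtain p where p: "trig p" and hp: "\<And>x. x \<in> cube3 \<Longrightarrow> \<bar>h x - p x\<bar> < min 1 d"
    by metis
  have [measurable]: "p \<in> borel_measurable T3" using p by (rule trig_measurable)
  have le: "(f x - p x) ^ 4 \<le> 64 * ((f x - g x) ^ 4 + (g x - h x) ^ 4 + d)" if "x \<in> cube3" for x
  proof -
    have "(h x - p x) ^ 4 = \<bar>h x - p x\<bar> ^ 3 * \<bar>h x - p x\<bar>" by (simp flip: power_Suc2)
    also have "\<dots> \<le> 1 ^ 3 * d"
      using hp[OF that] by (intro mult_mono power_mono) auto
    finally have 1: "(h x - p x) ^ 4 \<le> d" by simp
    have "(f x - p x) ^ 4 \<le> 8 * ((f x - g x) ^ 4 + (g x - p x) ^ 4)"
      using fourth_power_add_le[of "f x - g x" "g x - p x"] by simp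
    also have "(g x - p x) ^ 4 \<le> 8 * ((g x - h x) ^ 4 + (h x - p x) ^ 4)"
      using fourth_power_add_le[of "g x - h x" "h x - p x"] by simp
    finally have "(f x - p x) ^ 4 \<le> 8 * ((f x - g x) ^ 4 + 8 * ((g x - h x) ^ 4 + (h x - p x) ^ 4))" by simp
    moreover have "0 \<le> (f x - g x) ^ 4" by simp
    ultimately show ?thesis using 1 by argo
  qed
  have n': "integrable T3 (\<lambda>x. (f x - g x) ^ 4)" "(\<integral>x. (f x - g x) ^ 4 \<partial>T3) < d"
    using n by (auto simp: g_def)
  have bi: "integrable T3 (\<lambda>x. 64 * ((f x - g x) ^ 4 + (g x - h x) ^ 4 + d))"
    using n' h by simp
  have i: "integrable T3 (\<lambda>x. (f x - p x) ^ 4)"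
    by (rule Bochner_Integration.integrable_bound[OF bi]) (use le in \<open>force intro!: AE_I2\<close>)+
  have "(\<integral>x. (f x - p x) ^ 4 \<partial>T3) \<le> (\<integral>x. 64 * ((f x - g x) ^ 4 + (g x - h x) ^ 4 + d) \<partial>T3)"
    by (intro integral_mono i bi) (use le in simp)
  also have "\<dots> = 64 * ((\<integral>x. (f x - g x) ^ 4 \<partial>T3) + (\<integral>x. (g x - h x) ^ 4 \<partial>T3) + d)"
    using n' h measure_T3 by simp
  also have "64 * (a + b + d) < 256 * d" if "a < d" "b < d" for a b
    using that d by simp
  then have "64 * ((\<integral>x. (f x - g x) ^ 4 \<partial>T3) + (\<integral>x. (g x - h x) ^ 4 \<partial>T3) + d) < 256 * d"
    using n'(2) h(2) by blast
  also have "\<dots> = e" by (simp add: d_def)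
  finally show thesis using that p i by blast
qed

section \<open>Transfer of bounds by duality\<close>

lemma trig_bounded:
  assumes "trig p" obtains B where "B > 0" "\<And>x. x \<in> cube3 \<Longrightarrow> \<bar>p x\<bar> \<le> B"
proof -
  have "bounded (p ` cube3)"
    using compact_continuous_image[OF trig_continuous[OF assms], of cube3]
    by (simp add: cube3_def compact_imp_bounded)
  then show thesis using that by (auto simp: bounded_pos)
qed

text \<open>A crude substitute for Hoelder's inequality on a finite measure space: it makes products
  with bounded functions integrable and, after scaling, makes pairings small.\<close>

lemma abs_le_1_add_fourth_power: "\<bar>a\<bar> \<le> 1 + a ^ 4" for a :: real
proof (cases "\<bar>a\<bar> \<le> 1")
  case False
  then have "\<bar>a\<bar> ^ 1 \<le> \<bar>a\<bar> ^ 4" by (intro power_increasing) auto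
  then show ?thesis by simp
qed (simp add: add_increasing2)

lemma integrable_mult_trig:
  assumes [measurable]: "f \<in> borel_measurable T3" and int: "integrable T3 (\<lambda>x. f x ^ 4)" and p: "trig p"
  shows "integrable T3 (\<lambda>x. f x * p x)"
proof -
  have [measurable]: "p \<in> borel_measurable T3" using p by (rule trig_measurable)
  obtain B where B: "B > 0" "\<And>x. x \<in> cube3 \<Longrightarrow> \<bar>p x\<bar> \<le> B" using trig_bounded[OF p] by blast
  have "integrable T3 (\<lambda>x. (1 + f x ^ 4) * B)" using int by simp
  then show ?thesis
  proof (rule Bochner_Integration.integrable_bound)
    show "AE x in T3. norm (f x * p x) \<le> norm ((1 + f x ^ 4) * B)"
    proof (rule AE_I2)
      fix x assume "x \<in> space T3"
      then have "\<bar>f x\<bar> * \<bar>p x\<bar> \<le> (1 + f x ^ 4) * B"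
        using B abs_le_1_add_fourth_power by (intro mult_mono) auto
      then show "norm (f x * p x) \<le> norm ((1 + f x ^ 4) * B)" using B by (simp add: abs_mult)
    qed
  qed measurable
qed

text \<open>Compare \<open>h\<close> with the derivatives \<open>A u\<close> of the trigonometric solutions of \<open>u - \<Delta>u = g\<close>, where
  \<open>g\<close> is close to \<open>f\<close>, by testing with the cube of a trigonometric \<open>p\<close> that is close to \<open>h\<close>.\<close>

lemma L4_bound_transfer:
  fixes f h :: "real^3 \<Rightarrow> real" and A :: "(real^3 \<Rightarrow> real) \<Rightarrow> real^3 \<Rightarrow> real"
  assumes f: "f \<in> borel_measurable T3" "integrable T3 (\<lambda>x. f x ^ 4)"
    and h: "h \<in> borel_measurable T3" "integrable T3 (\<lambda>x. h x ^ 4)"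
    and trigA: "\<And>u. trig u \<Longrightarrow> trig (A u)"
    and s: "\<bar>s\<bar> = 1"
    and weak: "\<And>\<psi>. trig \<psi> \<Longrightarrow> (\<integral>x. h x * (\<psi> x - laplacian \<psi> x) \<partial>T3) = s * (\<integral>x. f x * A \<psi> x \<partial>T3)"
    and strong: "\<And>u \<psi>. trig u \<Longrightarrow> trig \<psi> \<Longrightarrow>
      (\<integral>x. A u x * (\<psi> x - laplacian \<psi> x) \<partial>T3) = s * (\<integral>x. (u x - laplacian u x) * A \<psi> x \<partial>T3)"
    and bound: "\<And>u. trig u \<Longrightarrow> (\<integral>x. A u x ^ 4 \<partial>T3) \<le> C * (\<integral>x. (u x - laplacian u x) ^ 4 \<partial>T3)"
    and C: "C \<ge> 0"
  shows "(\<integral>x. h x ^ 4 \<partial>T3) \<le> 128 * C * (\<integral>x. f x ^ 4 \<partial>T3)"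
proof -
  have sX: "s * X \<le> \<bar>X\<bar>" for X
    using abs_ge_self[of "s * X"] s unfolding abs_mult by simp
  \<comment> \<open>An estimate with an error linear in \<open>\<eta>\<close>. In
    \<open>128 = 8 * 16\<close> the \<open>16\<close> comes from bounding \<open>p\<close>, the
    \<open>8\<close> from passing from \<open>p\<close> back to \<open>h\<close>; likewise
    \<open>65672 = 8 * (8208 + 1)\<close>.\<close>
  have "(\<integral>x. h x ^ 4 \<partial>T3) \<le> 128 * C * (\<integral>x. f x ^ 4 \<partial>T3) + (128 * C + 65672) * \<eta>" if \<eta>: "\<eta> > 0" for \<eta>
  proof -
    obtain p where p [simp]: "trig p" and hp: "integrable T3 (\<lambda>x. (h x - p x) ^ 4)" "(\<integral>x. (h x - p x) ^ 4 \<partial>T3) < \<eta>"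
      using trig_dense_L4[OF h \<eta>] by blast
    have "trig (\<lambda>x. p x ^ 3)" by simp
    from resolvent[OF this] obtain \<psi> where \<psi> [simp]: "trig \<psi>" and p3: "\<And>x. p x ^ 3 = \<psi> x - laplacian \<psi> x"
      by blast
    have [simp]: "trig (A \<psi>)" using \<psi> by (rule trigA)
    then obtain B where B: "B > 0" "\<And>x. x \<in> cube3 \<Longrightarrow> \<bar>A \<psi> x\<bar> \<le> B"
      using trig_bounded by blast
    \<comment> \<open>The bound \<open>B\<close> depends on \<open>\<psi>\<close> and hence on
      \<open>p\<close>, so \<open>g\<close> has to be chosen last. The second entry keeps the
      pairing of \<open>f - g\<close> with \<open>A \<psi>\<close> small, the first one controls the
      fourth power of \<open>g\<close>.\<close>
    define \<delta> where "\<delta> = min \<eta> (\<eta> ^ 4 / B ^ 4)"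
    have \<delta>: "\<delta> > 0" using \<eta> B by (simp add: \<delta>_def)
    obtain g where g [simp]: "trig g" and fg: "integrable T3 (\<lambda>x. (f x - g x) ^ 4)" "(\<integral>x. (f x - g x) ^ 4 \<partial>T3) < \<delta>"
      using trig_dense_L4[OF f \<delta>] by blast
    obtain u where u [simp]: "trig u" and gu: "\<And>x. g x = u x - laplacian u x"
      using resolvent[OF g] by blast
    have [simp]: "trig (A u)" using u by (rule trigA)
    have hi [simp]: "integrable T3 (\<lambda>x. h x * q x)" if "trig q" for q
      using integrable_mult_trig[OF h that] .
    have fi [simp]: "integrable T3 (\<lambda>x. f x * q x)" if "trig q" for q
      using integrable_mult_trig[OF f that] .
    let ?P = "\<integral>x. p x ^ 4 \<partial>T3" and ?F = "\<integral>x. f x ^ 4 \<partial>T3"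

    \<comment> \<open>Because \<open>p^3\<close> is \<open>\<psi> - laplacian \<psi>\<close>, the
      weak and the strong identity both move \<open>A\<close> onto \<open>\<psi>\<close>, and only
      \<open>f - g\<close> is left.\<close>
    have "(\<integral>x. h x * p x ^ 3 \<partial>T3) - (\<integral>x. A u x * p x ^ 3 \<partial>T3)
        = s * ((\<integral>x. f x * A \<psi> x \<partial>T3) - (\<integral>x. g x * A \<psi> x \<partial>T3))"
      unfolding p3 gu weak[OF \<psi>] strong[OF u \<psi>] by (simp only: right_diff_distrib)
    also have "\<dots> \<le> \<bar>(\<integral>x. f x * A \<psi> x \<partial>T3) - (\<integral>x. g x * A \<psi> x \<partial>T3)\<bar>"
      by (rule sX)
    also have "(\<integral>x. f x * A \<psi> x \<partial>T3) - (\<integral>x. g x * A \<psi> x \<partial>T3) = (\<integral>x. (f x - g x) * A \<psi> x \<partial>T3)"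
      by (simp add: left_diff_distrib)
    also have "\<bar>\<dots>\<bar> \<le> (\<integral>x. \<bar>(f x - g x) * A \<psi> x\<bar> \<partial>T3)"
      by (rule integral_abs_bound)
    also have "\<dots> \<le> (\<integral>x. \<eta> + B ^ 4 / \<eta> ^ 3 * (f x - g x) ^ 4 \<partial>T3)"
    proof (rule integral_mono)
      show "integrable T3 (\<lambda>x. \<bar>(f x - g x) * A \<psi> x\<bar>)"
        by (simp add: left_diff_distrib)
      fix x assume x: "x \<in> space T3"
      define y where "y = B * \<bar>f x - g x\<bar> / \<eta>"
      have "\<bar>(f x - g x) * A \<psi> x\<bar> \<le> \<bar>f x - g x\<bar> * B"
        using B x by (simp add: abs_mult mult_left_mono)
      also have "\<dots> = \<eta> * y" using \<eta> by (simp add: y_def)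
      also have "\<dots> \<le> \<eta> * (1 + y ^ 4)"
        using abs_le_1_add_fourth_power[of y] \<eta> by (intro mult_left_mono) auto
      also have "\<dots> = \<eta> + B ^ 4 / \<eta> ^ 3 * (f x - g x) ^ 4"
        using \<eta> by (simp add: y_def distrib_left power_mult_distrib power_divide eval_nat_numeral)
      finally show "\<bar>(f x - g x) * A \<psi> x\<bar> \<le> \<eta> + B ^ 4 / \<eta> ^ 3 * (f x - g x) ^ 4" .
    qed (use fg in simp)
    also have "\<dots> = \<eta> + B ^ 4 / \<eta> ^ 3 * (\<integral>x. (f x - g x) ^ 4 \<partial>T3)"
      using fg measure_T3 by simp
    also have "\<dots> \<le> \<eta> + B ^ 4 / \<eta> ^ 3 * (\<eta> ^ 4 / B ^ 4)"
      using fg B \<eta> by (intro add_left_mono mult_left_mono) (auto simp: \<delta>_def)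
    also have "\<dots> = 2 * \<eta>" using B \<eta> by (simp add: eval_nat_numeral)
    finally have 1: "(\<integral>x. h x * p x ^ 3 \<partial>T3) \<le> (\<integral>x. A u x * p x ^ 3 \<partial>T3) + 2 * \<eta>" by simp

    have "(\<integral>x. A u x * p x ^ 3 \<partial>T3) \<le> (\<integral>x. 3 / 4 * p x ^ 4 + A u x ^ 4 / 4 \<partial>T3)"
      using Young_cubic by (intro integral_mono) (simp_all add: mult.commute)
    also have "\<dots> = 3 / 4 * ?P + (\<integral>x. A u x ^ 4 \<partial>T3) / 4" by simp
    finally have 2: "(\<integral>x. A u x * p x ^ 3 \<partial>T3) \<le> 3 / 4 * ?P + (\<integral>x. A u x ^ 4 \<partial>T3) / 4" .

    have "(\<integral>x. g x ^ 4 \<partial>T3) \<le> (\<integral>x. 8 * (f x ^ 4 + (f x - g x) ^ 4) \<partial>T3)"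
    proof (rule integral_mono)
      fix x
      have "(- (f x - g x)) ^ 4 = (f x - g x) ^ 4" by (rule power_minus_even) simp
      then show "g x ^ 4 \<le> 8 * (f x ^ 4 + (f x - g x) ^ 4)"
        using fourth_power_add_le[of "f x" "- (f x - g x)"] by simp
    qed (use f fg in simp_all)
    also have "\<dots> = 8 * (?F + (\<integral>x. (f x - g x) ^ 4 \<partial>T3))" using f fg by simp
    also have "\<dots> \<le> 8 * (?F + \<eta>)" using fg by (simp add: \<delta>_def)
    finally have "C * (\<integral>x. g x ^ 4 \<partial>T3) \<le> C * (8 * (?F + \<eta>))"
      by (rule mult_left_mono[OF _ C])
    then have 3: "(\<integral>x. A u x ^ 4 \<partial>T3) \<le> C * (8 * (?F + \<eta>))"
      using bound[OF u] unfolding gu[symmetric] by linarith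

    have "?P \<le> (\<integral>x. h x * p x ^ 3 + (p x ^ 4 / 8 + 1024 * (h x - p x) ^ 4) \<partial>T3)"
    proof (rule integral_mono)
      fix x
      define q r where "q = p x" and "r = h x"
      \<comment> \<open>The weights \<open>1/2\<close> and \<open>8\<close> reduce the coefficient
        of \<open>q^4\<close> to \<open>3/64\<close>, which is below \<open>1/8\<close>. Together
        with the \<open>3/4\<close> from the pairing with \<open>A u\<close>, at most
        \<open>7/8\<close> of \<open>?P\<close> stands on the right, so absorption costs a factor
        \<open>8\<close>.\<close>
      have "(q / 2) ^ 3 * (8 * (q - r)) \<le> 3 / 4 * (q / 2) ^ 4 + (8 * (q - r)) ^ 4 / 4"
        by (rule Young_cubic)
      moreover have "(q / 2) ^ 3 * (8 * (q - r)) = q ^ 4 - r * q ^ 3"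
        by (simp add: eval_nat_numeral algebra_simps)
      moreover have "(8 * (q - r)) ^ 4 = 4096 * (r - q) ^ 4"
        by (simp add: power_mult_distrib power4_eq_xxxx algebra_simps)
      moreover have "0 \<le> q ^ 4" "(q / 2) ^ 4 = q ^ 4 / 16" by (simp_all add: power_divide)
      ultimately show "q ^ 4 \<le> r * q ^ 3 + (q ^ 4 / 8 + 1024 * (r - q) ^ 4)"
        by linarith
    qed (use hp in simp_all)
    also have "\<dots> = (\<integral>x. h x * p x ^ 3 \<partial>T3) + (?P / 8 + 1024 * (\<integral>x. (h x - p x) ^ 4 \<partial>T3))"
      using hp by simp
    also have "\<dots> \<le> (\<integral>x. h x * p x ^ 3 \<partial>T3) + (?P / 8 + 1024 * \<eta>)"
      using hp by simp
    finally have "?P \<le> 8 * (C * (2 * (?F + \<eta>)) + 1026 * \<eta>)"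
      using 1 2 3 by argo
    then have 4: "?P \<le> 16 * C * ?F + (16 * C + 8208) * \<eta>" by (simp add: algebra_simps)

    have "(\<integral>x. h x ^ 4 \<partial>T3) \<le> (\<integral>x. 8 * (p x ^ 4 + (h x - p x) ^ 4) \<partial>T3)"
    proof (rule integral_mono)
      fix x
      show "h x ^ 4 \<le> 8 * (p x ^ 4 + (h x - p x) ^ 4)"
        using fourth_power_add_le[of "p x" "h x - p x"] by simp
    qed (use h hp in simp_all)
    also have "\<dots> = 8 * (?P + (\<integral>x. (h x - p x) ^ 4 \<partial>T3))" using hp by simp
    also have "\<dots> \<le> 8 * (16 * C * ?F + (16 * C + 8208) * \<eta> + \<eta>)"
      using 4 hp by simp
    finally show ?thesis by (simp add: algebra_simps)
  qed
  note * = this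
  show ?thesis
  proof (rule field_le_epsilon)
    fix e :: real assume "e > 0"
    then show "(\<integral>x. h x ^ 4 \<partial>T3) \<le> 128 * C * (\<integral>x. f x ^ 4 \<partial>T3) + e"
      using *[of "e / (128 * C + 65672)"] C by simp
  qed
qed

subsection \<open>Weak solutions\<close>

lemma partial_laplacian_commute:
  assumes "trig p" shows "partial i (laplacian p) = laplacian (partial i p)"
  using assms by (auto simp: trig_def laplacian_trig_poly partial_trig_poly multiplier_multiplier mult_ac)

lemma partial_resolvent_commute:
  assumes p [simp]: "trig p"
  shows "partial i (\<lambda>x. p x - laplacian p x) = (\<lambda>x. partial i p x - laplacian (partial i p) x)"
proof
  fix x
  have "partial i (\<lambda>x. p x + (-1) * laplacian p x) x = partial i p x + (-1) * partial i (laplacian p) x"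
    by (subst partial_add) (simp_all only: partial_scale trig_laplacian p trig_intros)
  then show "partial i (\<lambda>x. p x - laplacian p x) x = partial i p x - laplacian (partial i p) x"
    by (simp add: partial_laplacian_commute)
qed

lemma integral_laplacian_symmetric:
  assumes "trig p" "trig q"
  shows "(\<integral>x. p x * laplacian q x \<partial>T3) = (\<integral>x. laplacian p x * q x \<partial>T3)"
  using integral_laplacian_by_parts[OF assms] integral_laplacian_by_parts[OF assms(2,1)]
  by (simp add: mult.commute)

lemma integrable_fourth_power_add:
  fixes f g :: "real^3 \<Rightarrow> real"
  assumes [measurable]: "f \<in> borel_measurable T3" "g \<in> borel_measurable T3"
    and int: "integrable T3 (\<lambda>x. f x ^ 4)" "integrable T3 (\<lambda>x. g x ^ 4)"
  shows "integrable T3 (\<lambda>x. (f x + g x) ^ 4)"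
proof -
  have "integrable T3 (\<lambda>x. 8 * (f x ^ 4 + g x ^ 4))" using int by simp
  then show ?thesis
    by (rule Bochner_Integration.integrable_bound) (use fourth_power_add_le in auto)
qed

text \<open>Since \<open>A\<close> commutes with identity minus Laplacian, testing with
  \<open>\<psi> - laplacian \<psi>\<close> lets that operator fall on \<open>A \<psi>\<close>, from
  where \<open>lap\<close> moves it to \<open>u\<close>. Below it serves the weak solution and also
  trigonometric \<open>v\<close> with \<open>l = laplacian v\<close>.\<close>

lemma weak_resolvent:
  fixes u l h :: "real^3 \<Rightarrow> real" and A :: "(real^3 \<Rightarrow> real) \<Rightarrow> real^3 \<Rightarrow> real"
  assumes trigA: "\<And>v. trig v \<Longrightarrow> trig (A v)"
    and commute: "\<And>v. trig v \<Longrightarrow> A (\<lambda>x. v x - laplacian v x) = (\<lambda>x. A v x - laplacian (A v) x)"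
    and int: "\<And>v. trig v \<Longrightarrow> integrable T3 (\<lambda>x. u x * v x)" "\<And>v. trig v \<Longrightarrow> integrable T3 (\<lambda>x. l x * v x)"
    and lap: "\<And>v. trig v \<Longrightarrow> (\<integral>x. u x * laplacian v x \<partial>T3) = (\<integral>x. l x * v x \<partial>T3)"
    and weak: "\<And>v. trig v \<Longrightarrow> (\<integral>x. h x * v x \<partial>T3) = s * (\<integral>x. u x * A v x \<partial>T3)"
    and \<psi>: "trig \<psi>"
  shows "(\<integral>x. h x * (\<psi> x - laplacian \<psi> x) \<partial>T3) = s * (\<integral>x. (u x - l x) * A \<psi> x \<partial>T3)"
proof -
  have A\<psi> [simp]: "trig (A \<psi>)" by (rule trigA[OF \<psi>])
  have "(\<integral>x. h x * (\<psi> x - laplacian \<psi> x) \<partial>T3) = s * (\<integral>x. u x * (A \<psi> x - laplacian (A \<psi>) x) \<partial>T3)"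
    using weak[of "\<lambda>x. \<psi> x - laplacian \<psi> x"] \<psi> by (simp add: commute)
  also have "(\<integral>x. u x * (A \<psi> x - laplacian (A \<psi>) x) \<partial>T3) = (\<integral>x. (u x - l x) * A \<psi> x \<partial>T3)"
    using int by (simp add: right_diff_distrib left_diff_distrib lap)
  finally show ?thesis .
qed

text \<open>\<open>l\<close> is the weak Laplacian of \<open>u\<close>, \<open>h\<close> is the weak
  \<open>A u\<close>, and \<open>s\<close> is the sign in the adjoint of \<open>A\<close>. Thus
  \<open>u\<close> solves the resolvent equation weakly with right-hand side \<open>u - l\<close>.
  The constant is \<open>128 * 20000 * 8\<close>.\<close>

lemma weak_solution_estimate:
  fixes u l h :: "real^3 \<Rightarrow> real" and A :: "(real^3 \<Rightarrow> real) \<Rightarrow> real^3 \<Rightarrow> real"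
  assumes u: "u \<in> borel_measurable T3" "integrable T3 (\<lambda>x. u x ^ 4)"
    and l: "l \<in> borel_measurable T3" "integrable T3 (\<lambda>x. l x ^ 4)"
    and h: "h \<in> borel_measurable T3" "integrable T3 (\<lambda>x. h x ^ 4)"
    and trigA: "\<And>v. trig v \<Longrightarrow> trig (A v)"
    and commute: "\<And>v. trig v \<Longrightarrow> A (\<lambda>x. v x - laplacian v x) = (\<lambda>x. A v x - laplacian (A v) x)"
    and s: "\<bar>s\<bar> = 1"
    and adjoint: "\<And>v w. trig v \<Longrightarrow> trig w \<Longrightarrow> (\<integral>x. A v x * w x \<partial>T3) = s * (\<integral>x. v x * A w x \<partial>T3)"
    and bound: "\<And>v. trig v \<Longrightarrow> (\<integral>x. A v x ^ 4 \<partial>T3) \<le> 20000 * (\<integral>x. (v x - laplacian v x) ^ 4 \<partial>T3)"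
    and lap: "\<And>v. trig v \<Longrightarrow> (\<integral>x. u x * laplacian v x \<partial>T3) = (\<integral>x. l x * v x \<partial>T3)"
    and weak: "\<And>v. trig v \<Longrightarrow> (\<integral>x. h x * v x \<partial>T3) = s * (\<integral>x. u x * A v x \<partial>T3)"
  shows "(\<integral>x. h x ^ 4 \<partial>T3) \<le> 20480000 * ((\<integral>x. u x ^ 4 \<partial>T3) + (\<integral>x. l x ^ 4 \<partial>T3))"
proof -
  note [measurable] = u(1) l(1)
  have pt: "(u x - l x) ^ 4 \<le> 8 * (u x ^ 4 + l x ^ 4)" for x
    using fourth_power_add_le[of "u x" "- l x"] by simp
  have bi: "integrable T3 (\<lambda>x. 8 * (u x ^ 4 + l x ^ 4))" using u l by simp
  have fi: "integrable T3 (\<lambda>x. (u x - l x) ^ 4)"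
    using integrable_fourth_power_add[of u "\<lambda>x. - l x"] u l by simp
  have "(\<integral>x. h x ^ 4 \<partial>T3) \<le> 128 * 20000 * (\<integral>x. (u x - l x) ^ 4 \<partial>T3)"
  proof (rule L4_bound_transfer[OF _ fi h trigA s _ _ bound])
    show "(\<integral>x. h x * (\<psi> x - laplacian \<psi> x) \<partial>T3) = s * (\<integral>x. (u x - l x) * A \<psi> x \<partial>T3)" if "trig \<psi>" for \<psi>
      by (rule weak_resolvent[OF trigA commute _ _ lap weak that])
        (auto intro: integrable_mult_trig u l)
    show "(\<integral>x. A v x * (\<psi> x - laplacian \<psi> x) \<partial>T3) = s * (\<integral>x. (v x - laplacian v x) * A \<psi> x \<partial>T3)"
      if "trig v" "trig \<psi>" for v \<psi>
      by (rule weak_resolvent[OF trigA commute _ _ integral_laplacian_symmetric adjoint]) (use that in simp_all)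
  qed auto
  also have "(\<integral>x. (u x - l x) ^ 4 \<partial>T3) \<le> (\<integral>x. 8 * (u x ^ 4 + l x ^ 4) \<partial>T3)"
    by (intro integral_mono fi bi pt)
  also have "(\<integral>x. 8 * (u x ^ 4 + l x ^ 4) \<partial>T3) = 8 * ((\<integral>x. u x ^ 4 \<partial>T3) + (\<integral>x. l x ^ 4 \<partial>T3))"
    using u l by simp
  finally show ?thesis by simp
qed

section \<open>Norms of vector-valued functions and the size of the constant\<close>

lemma inL4_component:
  fixes F :: "real^3 \<Rightarrow> 'a::euclidean_space^'n"
  assumes "inL4 F" shows "inL4 (\<lambda>x. F x $ i)"
proof -
  note [measurable] = assms[unfolded inL4_def, THEN conjunct1]
  have "(\<lambda>y::'a^'n. y $ i) \<in> borel_measurable borel"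
    by (intro borel_measurable_continuous_onI continuous_on_component continuous_on_id)
  then have [measurable]: "(\<lambda>x. F x $ i) \<in> borel_measurable T3"
    by (rule measurable_compose[rotated]) measurable
  have "integrable T3 (\<lambda>x. norm (F x) ^ 4)" using assms by (simp add: inL4_def)
  then have "integrable T3 (\<lambda>x. norm (F x $ i) ^ 4)"
  proof (rule Bochner_Integration.integrable_bound)
    have "norm (F x $ i) ^ 4 \<le> norm (F x) ^ 4" for x
      by (intro power_mono Finite_Cartesian_Product.norm_nth_le) simp_all
    then show "AE x in T3. norm (norm (F x $ i) ^ 4) \<le> norm (norm (F x) ^ 4)" by simp
  qed measurable
  then show ?thesis by (simp add: inL4_def)
qed

text \<open>Cauchy-Schwarz for three squares. Components in a normed space allow two applications to
  the Hessian, first to its rows and then to their entries.\<close>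

lemma norm_fourth_power_le:
  fixes a :: "'a::real_normed_vector^3"
  shows "norm a ^ 4 \<le> 3 * (\<Sum>i\<in>UNIV. norm (a $ i) ^ 4)"
proof -
  have "norm a ^ 4 = ((norm a)\<^sup>2)\<^sup>2" by simp
  also have "(norm a)\<^sup>2 = (\<Sum>i\<in>UNIV. (norm (a $ i))\<^sup>2)"
    by (simp add: norm_vec_def L2_set_def sum_nonneg)
  also have "(\<Sum>i\<in>UNIV. (norm (a $ i))\<^sup>2)\<^sup>2 \<le> 3 * (\<Sum>i\<in>UNIV. ((norm (a $ i))\<^sup>2)\<^sup>2)"
    using sum_squared_le_sum_of_squares[of "\<lambda>i. (norm (a $ i))\<^sup>2" "UNIV :: 3 set"] by simp
  finally show ?thesis by simp
qed

lemma L4norm_nonneg: "0 \<le> L4norm F"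
  by (simp add: L4norm_def)

lemma L4norm_power4: "L4norm F ^ 4 = (\<integral>x. norm (F x) ^ 4 \<partial>T3)"
proof -
  have 0: "0 \<le> (\<integral>x. norm (F x) ^ 4 \<partial>T3)" by simp
  then show ?thesis unfolding L4norm_def
    by (cases "(\<integral>x. norm (F x) ^ 4 \<partial>T3) = 0") (simp_all add: powr_power)
qed

lemma L4norm_le:
  assumes "(\<integral>x. norm (F x) ^ 4 \<partial>T3) \<le> c ^ 4" "0 \<le> c" shows "L4norm F \<le> c"
  using assms(1) power_mono_iff[OF L4norm_nonneg[of F] assms(2), of 4] by (simp add: L4norm_power4)

text \<open>\<open>C_Lchi\<close> collapses to \<open>10 * sqrt 3\<close> and \<open>C_reg\<close>
  is at least \<open>9 * 193\<close>, so their product already exceeds the bound and the other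
  summands need only be nonnegative. The target is \<open>2001 = 1 + 1000 + 1000\<close>, for
  function, gradient and Hessian.\<close>

lemma C_S_ge: "2001 \<le> C_S"
proof -
  have s: "sqrt 3 ^ 2 = 3" "sqrt 3 ^ 3 = 3 * sqrt 3" by (simp_all add: eval_nat_numeral)
  have "C_Lchi = 10 * sqrt 3"
    unfolding C_Lchi_def by (simp add: s power2_sum power3_eq_cube algebra_simps)
      (simp add: field_simps flip: power2_eq_square)
  moreover have "10 * 1 \<le> 10 * sqrt 3" by (intro mult_left_mono) simp_all
  ultimately have L: "10 \<le> C_Lchi" by linarith
  have "1737 * 1 \<le> C_reg"
    unfolding C_reg_def C_CZ_def C_P_def by simp
  then have R: "1737 \<le> C_reg" by simp
  have s17: "(6 / 5)\<^sup>2 \<le> (3::real)" by (simp add: power2_eq_square)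
  then have "6 / 5 \<le> sqrt 3" by (rule real_le_rsqrt)
  then have D: "0 \<le> C_D2chi" by (simp add: C_D2chi_def)
  have "17370 \<le> C_reg * C_Lchi"
    using mult_mono[OF R L] R by simp
  moreover have "0 \<le> (2 + 54 * 27 * sqrt 17) * C_reg * C_H * C_D2chi * K_const"
    using R D by (intro mult_nonneg_nonneg add_nonneg_nonneg) (simp_all add: C_H_def K_const_def)
  ultimately show ?thesis unfolding C_S_def by simp
qed

theorem theorem2p6:
  fixes u :: "real^3 \<Rightarrow> real" and G :: "real^3 \<Rightarrow> real^3" and H :: "real^3 \<Rightarrow> real^3^3"
  assumes "W24_weak u G H"
  shows "W24norm u G H \<le> C_S * (L4norm (lap H) + L4norm u)"
proof -
  have L4: "inL4 u" "inL4 G" "inL4 H"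
    and G: "trig \<phi> \<Longrightarrow> (\<integral>x. u x * partial i \<phi> x \<partial>T3) = - (\<integral>x. G x $ i * \<phi> x \<partial>T3)"
    and H: "trig \<phi> \<Longrightarrow> (\<integral>x. u x * partial i (partial j \<phi>) x \<partial>T3) = (\<integral>x. H x $ i $ j * \<phi> x \<partial>T3)" for \<phi> i j
    using assms trig_test_fun unfolding W24_weak_def by blast+
  have u: "u \<in> borel_measurable T3" "integrable T3 (\<lambda>x. u x ^ 4)"
    using L4(1) by (auto simp: inL4_def)
  have Gi: "(\<lambda>x. G x $ i) \<in> borel_measurable T3" "integrable T3 (\<lambda>x. (G x $ i) ^ 4)" for i
    using inL4_component[OF L4(2), of i] by (simp_all add: inL4_def)
  have Hij: "(\<lambda>x. H x $ i $ j) \<in> borel_measurable T3" "integrable T3 (\<lambda>x. (H x $ i $ j) ^ 4)" for i j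
    using inL4_component[OF inL4_component[OF L4(3), of i], of j] by (simp_all add: inL4_def)
  note [measurable] = u(1) Hij(1) Gi(1)
  have l: "lap H \<in> borel_measurable T3" "integrable T3 (\<lambda>x. lap H x ^ 4)"
  proof -
    have lap3: "lap H = (\<lambda>x. H x $ 1 $ 1 + H x $ 2 $ 2 + H x $ 3 $ 3)"
      by (simp add: lap_def sum_3 fun_eq_iff)
    show "lap H \<in> borel_measurable T3" unfolding lap3 by measurable
    show "integrable T3 (\<lambda>x. lap H x ^ 4)"
      unfolding lap3 by (intro integrable_fourth_power_add borel_measurable_add Hij)
  qed
  have lap: "(\<integral>x. u x * laplacian v x \<partial>T3) = (\<integral>x. lap H x * v x \<partial>T3)" if "trig v" for v
  proof -
    have "(\<integral>x. u x * laplacian v x \<partial>T3) = (\<Sum>i\<in>UNIV. \<integral>x. u x * partial i (partial i v) x \<partial>T3)"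
      unfolding laplacian_def sum_distrib_left
      by (intro Bochner_Integration.integral_sum integrable_mult_trig u) (use that in simp)
    also have "\<dots> = (\<Sum>i\<in>UNIV. \<integral>x. H x $ i $ i * v x \<partial>T3)" by (simp add: H that)
    also have "\<dots> = (\<integral>x. lap H x * v x \<partial>T3)"
      unfolding lap_def sum_distrib_right
      by (intro Bochner_Integration.integral_sum[symmetric] integrable_mult_trig Hij that)
    finally show ?thesis .
  qed
  define a b where "a = L4norm (lap H)" and "b = L4norm u"
  have ab: "0 \<le> a" "0 \<le> b" by (simp_all add: a_def b_def L4norm_nonneg)
  have X: "(\<integral>x. u x ^ 4 \<partial>T3) + (\<integral>x. lap H x ^ 4 \<partial>T3) \<le> (a + b) ^ 4"
  proof -
    have "(\<integral>x. u x ^ 4 \<partial>T3) + (\<integral>x. lap H x ^ 4 \<partial>T3) = b ^ 4 + a ^ 4"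
      by (simp add: a_def b_def L4norm_power4)
    also have "\<dots> \<le> (a + b) ^ 4"
      using ab by (simp add: eval_nat_numeral algebra_simps)
    finally show ?thesis .
  qed
  have comm: "partial i (partial j (\<lambda>x. v x - laplacian v x)) = (\<lambda>x. partial i (partial j v) x - laplacian (partial i (partial j v)) x)"
    if "trig v" for v i j
    using that by (simp add: partial_resolvent_commute)
  have "(\<integral>x. (G x $ i) ^ 4 \<partial>T3) \<le> 20480000 * ((\<integral>x. u x ^ 4 \<partial>T3) + (\<integral>x. lap H x ^ 4 \<partial>T3))" for i
    \<comment> \<open>A first derivative is skew-adjoint, hence \<open>s = -1\<close>; the second
      derivatives further down are self-adjoint, hence \<open>s = 1\<close>.\<close>
    by (rule weak_solution_estimate[OF u l Gi, where A = "partial i" and s = "-1"])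
      (simp_all add: lap G partial_resolvent_commute integral_by_parts resolvent_derivative_estimates(2))
  then have G4: "(\<integral>x. (G x $ i) ^ 4 \<partial>T3) \<le> 20480000 * (a + b) ^ 4" for i
    using X by (meson mult_left_mono order_trans zero_le_numeral)
  have "(\<integral>x. (H x $ i $ j) ^ 4 \<partial>T3) \<le> 20480000 * ((\<integral>x. u x ^ 4 \<partial>T3) + (\<integral>x. lap H x ^ 4 \<partial>T3))" for i j
  proof (rule weak_solution_estimate[OF u l Hij, where A = "\<lambda>v. partial i (partial j v)" and s = 1])
    show "(\<integral>x. partial i (partial j v) x * w x \<partial>T3) = 1 * (\<integral>x. v x * partial i (partial j w) x \<partial>T3)"
      if "trig v" "trig w" for v w
      using that integral_by_parts[of w "partial j v" i] integral_by_parts[of "partial i w" v j]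
      by (simp add: mult.commute trig_partial_commute[of w])
  qed (simp_all add: lap H comm resolvent_derivative_estimates(1))
  then have H4: "(\<integral>x. (H x $ i $ j) ^ 4 \<partial>T3) \<le> 20480000 * (a + b) ^ 4" for i j
    using X by (meson mult_left_mono order_trans zero_le_numeral)
  \<comment> \<open>Summing components gives \<open>9 * 20480000\<close> for the gradient and
    \<open>81 * 20480000\<close> for the Hessian, both well below \<open>1000 ^ 4\<close>.\<close>
  have "L4norm G \<le> 1000 * (a + b)"
  proof (rule L4norm_le)
    have "(\<integral>x. norm (G x) ^ 4 \<partial>T3) \<le> (\<integral>x. 3 * (\<Sum>i\<in>UNIV. (G x $ i) ^ 4) \<partial>T3)"
      using norm_fourth_power_le[of "G x" for x] L4(2) Gi by (intro integral_mono) (simp_all add: inL4_def)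
    also have "\<dots> = 3 * (\<Sum>i\<in>UNIV. \<integral>x. (G x $ i) ^ 4 \<partial>T3)" using Gi by simp
    also have "\<dots> \<le> 3 * (\<Sum>i\<in>(UNIV :: 3 set). 20480000 * (a + b) ^ 4)"
      by (intro mult_left_mono sum_mono G4) simp
    also have "\<dots> \<le> 1000 ^ 4 * (a + b) ^ 4" using ab by simp
    finally show "(\<integral>x. norm (G x) ^ 4 \<partial>T3) \<le> (1000 * (a + b)) ^ 4" by (simp only: power_mult_distrib)
  qed (use ab in simp)
  moreover have "L4norm H \<le> 1000 * (a + b)"
  proof (rule L4norm_le)
    have "(\<integral>x. norm (H x) ^ 4 \<partial>T3) \<le> (\<integral>x. 9 * (\<Sum>i\<in>UNIV. \<Sum>j\<in>UNIV. (H x $ i $ j) ^ 4) \<partial>T3)"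
    proof (rule integral_mono)
      fix x
      have "norm (H x) ^ 4 \<le> 3 * (\<Sum>i\<in>UNIV. norm (H x $ i) ^ 4)" by (rule norm_fourth_power_le)
      also have "\<dots> \<le> 3 * (\<Sum>i\<in>UNIV. 3 * (\<Sum>j\<in>UNIV. norm (H x $ i $ j) ^ 4))"
        by (intro mult_left_mono sum_mono norm_fourth_power_le) simp
      finally show "norm (H x) ^ 4 \<le> 9 * (\<Sum>i\<in>UNIV. \<Sum>j\<in>UNIV. (H x $ i $ j) ^ 4)"
        by (simp add: sum_distrib_left)
    qed (use L4(3) Hij in \<open>simp_all add: inL4_def\<close>)
    also have "\<dots> = 9 * (\<Sum>i\<in>UNIV. \<Sum>j\<in>UNIV. \<integral>x. (H x $ i $ j) ^ 4 \<partial>T3)" using Hij by simp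
    also have "\<dots> \<le> 9 * (\<Sum>i\<in>(UNIV :: 3 set). \<Sum>j\<in>(UNIV :: 3 set). 20480000 * (a + b) ^ 4)"
      by (intro mult_left_mono sum_mono H4) simp
    also have "\<dots> \<le> 1000 ^ 4 * (a + b) ^ 4" using ab by simp
    finally show "(\<integral>x. norm (H x) ^ 4 \<partial>T3) \<le> (1000 * (a + b)) ^ 4" by (simp only: power_mult_distrib)
  qed (use ab in simp)
  ultimately have "W24norm u G H \<le> 2001 * (a + b)"
    using ab by (simp add: W24norm_def b_def)
  also have "\<dots> \<le> C_S * (a + b)" using ab C_S_ge by (intro mult_right_mono) auto
  finally show ?thesis by (simp add: a_def b_def)
qed

end
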